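(* In every degenerate geometric algebra $C\ell_{p,q,r}$, $p+q+r=n\ge1$, $r\neq0$, the groups $B^{\overline{12}}_{p,q,r}$, $B^{\overline{03}}_{p,q,r}$, $\check B^{\overline{23}}_{p,q,r}$ and $\check B_{p,q,r}$ (defined in the context) are related by $$B^{\overline{12}}_{p,q,r}=\check B_{p,q,r}\,Z^{\times}_{p,q,r},$$ $$\check B^{\overline{23}}_{p,q,r}=\check B_{p,q,r}\,(\check Z^2_{p,q,r}\cap\check Z^3_{p,q,r})^{\times},\qquad B^{\overline{03}}_{p,q,r}=\check B_{p,q,r}\,Z^{3\times}_{p,q,r},$$ where for sets $G,H$ the product $GH$ denotes $\{gh:\ g\in G,\ h\in H\}$.
   Context: $C\ell_{p,q,r}$, $p+q+r=n\ge1$, is the Clifford (geometric) algebra over the real space $\mathbb{R}^{p,q,r}$ or the complex space $\mathbb{C}^{p+q,0,r}$ (field $\mathbb{F}=\mathbb{R}$ or $\mathbb{C}$ respectively), with identity $e$ and generators $e_1,\dots,e_n$ satisfying $e_ae_b+e_be_a=2\eta_{ab}e$, where $\eta$ is diagonal with $p$ entries $+1$, then $q$ entries $-1$, then $r$ entries $0$ (in the complex case, $p+q$ entries $+1$ and $r$ entries $0$). $C\ell^k_{p,q,r}$ is the grade-$k$ subspace, spanned by $e_{a_1}\cdots e_{a_k}$, $a_1<\dots<a_k$ (it is $\{0\}$ for $k<0$ or $k>n$). $\Lambda_r=C\ell_{0,0,r}$ is the Grassmann subalgebra generated by the $r$ null generators $e_{p+q+1},\dots,e_n$. $\widehat U$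 is the grade involution (multiplication by $(-1)^k$ on grade $k$), $\widetilde U$ is the reversion (multiplication by $(-1)^{k(k-1)/2}$ on grade $k$, an anti-automorphism), $\widehat{\widetilde U}$ is the Clifford conjugation. $C\ell^{(0)}_{p,q,r}$ is the even subspace and $\Lambda^{(0)}_r=\Lambda_r\cap C\ell^{(0)}_{p,q,r}$. For a subset $H\subseteq C\ell_{p,q,r}$, $H^\times$ denotes the set of invertible elements of $H$. $Z_{p,q,r}$ is the center of $C\ell_{p,q,r}$. Centralizers and twisted centralizers of grade subspaces: $Z^m_{p,q,r}=\{X\in C\ell_{p,q,r}:\ XV=VX\ \ \forall V\in C\ell^m_{p,q,r}\}$ and $\check Z^m_{p,q,r}=\{X\in C\ell_{p,q,r}:\ \widehat XV=VX\ \ \forall V\in C\ell^m_{p,q,r}\}$ (if $m>n$, then $C\ell^m_{p,q,r}=\{0\}$ and both are all of $C\ell_{p,q,r}$). One has $Z^1_{p,q,r}=Z_{p,q,r}$. Groups: $B^{\overline{12}}_{p,q,r}=\{T\in C\ell^\times_{p,q,r}:\ \widehat{\widetilde T}T\in Z^{1\times}_{p,q,r}\}$, $B^{\overline{03}}_{p,q,r}=\{T\in C\ell^\times_{p,q,r}:\ \widehat{\widetilde T}T\in Z^{3\times}_{p,q,r}\}$, $\check B^{\overline{23}}_{p,q,r}=\{T\in C\ell^\times_{p,q,r}:\ \widehat{\widetilde T}T\in(\check Z^2_{p,q,r}\cap\check Z^3_{p,q,r})^\times\}$, $\check B_{p,q,r}=\{T\in C\ell^\times_{p,q,r}:\ \widehat{\widetilde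 T}T\in\Lambda^{(0)\times}_r\}$. *)

theory Defs
  imports Complex_Main "HOL-Algebra.Ring" "HOL-Algebra.Coset"
begin

section \<open>The Clifford algebra of a (possibly degenerate) diagonal form\<close>

text \<open>
  A multivector is the family of its coordinates with respect to the basis of ordered products
  \<open>e\<^sub>A = e\<^bsub>a1\<^esub> \<cdots> e\<^bsub>ak\<^esub>\<close>, where \<open>A = {a1 < \<dots> < ak} \<subseteq> {1..n}\<close> and \<open>n = p + q + r\<close>. The lemmas below show
  that the structure defined here is a ring, that the generators satisfy the defining relations,
  and that the basis element with index \<open>A\<close> is indeed the ordered product of the generators
  \<open>e\<^sub>a\<close>, \<open>a \<in> A\<close>.
\<close>

type_synonym 'a multivector = "nat set \<Rightarrow> 'a"

definition cl_eta :: "nat \<Rightarrow> nat \<Rightarrow> nat \<Rightarrow> 'a::field" where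
  "cl_eta p q i = (if i \<le> p then 1 else if i \<le> p + q then -1 else 0)"

text \<open>
  Structure constants: \<open>e\<^sub>A e\<^sub>B\<close> is \<open>cl_coeff p q A B\<close> times the basis element of the symmetric difference.
  Sorting the word \<open>e\<^sub>A e\<^sub>B\<close> costs a sign for each pair \<open>b < a\<close> with \<open>a \<in> A\<close>, \<open>b \<in> B\<close>, and then each
  repeated generator contributes its square.
\<close>

definition cl_coeff :: "nat \<Rightarrow> nat \<Rightarrow> nat set \<Rightarrow> nat set \<Rightarrow> 'a::field" where
  "cl_coeff p q A B =
     (\<Prod>a\<in>A. \<Prod>b\<in>B. if b < a then -1 else 1) * (\<Prod>i\<in>A \<inter> B. cl_eta p q i)"

definition cl_mult ::
  "nat \<Rightarrow> nat \<Rightarrow> nat \<Rightarrow> 'a::field multivector \<Rightarrow> 'a multivector \<Rightarrow> 'a multivector" where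
  "cl_mult p q r x y = (\<lambda>C. \<Sum>A\<in>Pow {1..p+q+r}. \<Sum>B\<in>Pow {1..p+q+r}.
     if sym_diff A B = C then cl_coeff p q A B * x A * y B else 0)"

definition cl_basis :: "nat set \<Rightarrow> 'a::field multivector" where
  "cl_basis A = (\<lambda>B. if B = A then 1 else 0)"

definition cl_gen :: "nat \<Rightarrow> 'a::field multivector" where
  "cl_gen i = cl_basis {i}"

definition cl_smult :: "'a::field \<Rightarrow> 'a multivector \<Rightarrow> 'a multivector" where
  "cl_smult c x = (\<lambda>A. c * x A)"

definition Cl :: "nat \<Rightarrow> nat \<Rightarrow> nat \<Rightarrow> 'a::field multivector ring" where
  "Cl p q r = \<lparr> carrier = {x. \<forall>A. x A \<noteq> 0 \<longrightarrow> A \<subseteq> {1..p+q+r}},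
                monoid.mult = cl_mult p q r,
                one = cl_basis {},
                ring.zero = (\<lambda>A. 0),
                add = (\<lambda>x y A. x A + y A) \<rparr>"

lemma Cl_simps:
  "x \<in> carrier (Cl p q r) \<longleftrightarrow> (\<forall>A. x A \<noteq> 0 \<longrightarrow> A \<subseteq> {1..p+q+r})"
  "x \<otimes>\<^bsub>Cl p q r\<^esub> y = cl_mult p q r x y"
  "\<one>\<^bsub>Cl p q r\<^esub> = cl_basis {}"
  "\<zero>\<^bsub>Cl p q r\<^esub> = (\<lambda>A. 0)"
  "x \<oplus>\<^bsub>Cl p q r\<^esub> y = (\<lambda>A. x A + y A)"
  by (simp_all add: Cl_def)

subsection \<open>It is a ring\<close>

lemma prod_sym_diff:
  fixes f :: "'b \<Rightarrow> 'a::comm_ring_1"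
  assumes "finite A" "finite B" "\<And>x. f x * f x = 1"
  shows "prod f (sym_diff A B) = prod f A * prod f B"
proof -
  have A: "prod f A = prod f (A - B) * prod f (A \<inter> B)"
    using assms(1) by (subst prod.union_disjoint[symmetric]) (auto intro: arg_cong[where f="prod f"])
  have B: "prod f B = prod f (B - A) * prod f (A \<inter> B)"
    using assms(2) by (subst prod.union_disjoint[symmetric]) (auto intro: arg_cong[where f="prod f"])
  have AB: "prod f (sym_diff A B) = prod f (A - B) * prod f (B - A)"
    using assms(1,2) by (subst prod.union_disjoint[symmetric]) auto
  have "prod f (A \<inter> B) * prod f (A \<inter> B) = 1"
    by (simp add: prod.distrib[symmetric] assms(3))
  then show ?thesis unfolding A B AB
    by (metis (no_types, lifting) mult.assoc mult.commute mult.right_neutral)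
qed

lemma cl_coeff_assoc:
  assumes "finite A" "finite B" "finite C"
  shows "cl_coeff p q (sym_diff A B) C * cl_coeff p q A B =
         (cl_coeff p q A (sym_diff B C) * cl_coeff p q B C :: 'a::field)"
proof -
  define s where "s A B = (\<Prod>a\<in>A. \<Prod>b\<in>B. if b < a then -1 else (1::'a))" for A B :: "nat set"
  define h where "h S = (\<Prod>i\<in>S. cl_eta p q i :: 'a)" for S
  have coeff: "cl_coeff p q A B = s A B * h (A \<inter> B)" for A B
    by (simp add: cl_coeff_def s_def h_def)
  have sq: "(\<Prod>b\<in>B. if b < a then -1 else (1::'a)) * (\<Prod>b\<in>B. if b < a then -1 else 1) = 1"
    for a :: nat and B
    by (subst prod.distrib[symmetric]) (auto intro!: prod.neutral)
  have s1: "s (sym_diff A B) C = s A C * s B C"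
    unfolding s_def by (rule prod_sym_diff) (use assms sq in auto)
  have s2: "s A (sym_diff B C) = s A B * s A C"
  proof -
    have "(\<Prod>b\<in>sym_diff B C. if b < a then -1 else (1::'a)) =
          (\<Prod>b\<in>B. if b < a then -1 else 1) * (\<Prod>b\<in>C. if b < a then -1 else 1)" for a :: nat
      by (rule prod_sym_diff) (use assms in auto)
    then show ?thesis by (simp add: s_def prod.distrib)
  qed
  have h1: "h (sym_diff A B \<inter> C) * h (A \<inter> B) = h ((A \<inter> B) \<union> (A \<inter> C) \<union> (B \<inter> C))"
    unfolding h_def using assms
    by (subst prod.union_disjoint[symmetric]) (auto intro: arg_cong[where f="prod _"])
  have h2: "h (A \<inter> sym_diff B C) * h (B \<inter> C) = h ((A \<inter> B) \<union> (A \<inter> C) \<union> (B \<inter> C))"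
    unfolding h_def using assms
    by (subst prod.union_disjoint[symmetric]) (auto intro: arg_cong[where f="prod _"])
  have "cl_coeff p q (sym_diff A B) C * cl_coeff p q A B
      = s A C * s B C * s A B * (h (sym_diff A B \<inter> C) * h (A \<inter> B))"
    by (simp only: coeff s1 mult_ac)
  also have "\<dots> = s A C * s B C * s A B * (h (A \<inter> sym_diff B C) * h (B \<inter> C))"
    by (simp only: h1 h2)
  also have "\<dots> = cl_coeff p q A (sym_diff B C) * cl_coeff p q B C"
    by (simp only: coeff s2 mult_ac)
  finally show ?thesis .
qed

lemma cl_coeff_empty [simp]: "cl_coeff p q {} B = 1" "cl_coeff p q A {} = 1"
  by (simp_all add: cl_coeff_def)

lemma cl_mult_closed:
  "x \<in> carrier (Cl p q r) \<Longrightarrow> y \<in> carrier (Cl p q r) \<Longrightarrow> cl_mult p q r x y \<in> carrier (Cl p q r)"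
  unfolding Cl_simps cl_mult_def
  by (fastforce elim!: sum.not_neutral_contains_not_neutral split: if_splits)

lemma cl_mult_assoc:
  "cl_mult p q r (cl_mult p q r x y) z = cl_mult p q r x (cl_mult p q r y z)"
proof
  fix D
  define P where "P = Pow {1..p+q+r}"
  have fin: "finite P" "\<And>A. A \<in> P \<Longrightarrow> finite A"
    by (auto simp: P_def intro: finite_subset)
  have P: "sym_diff A B \<in> P" if "A \<in> P" "B \<in> P" for A B using that by (auto simp: P_def)
  have sd: "sym_diff (sym_diff A B) C = sym_diff A (sym_diff B C)" for A B C :: "nat set" by auto
  have swap3: "(\<Sum>E\<in>P. \<Sum>C\<in>P. \<Sum>A\<in>P. \<Sum>B\<in>P. g E C A B) = (\<Sum>A\<in>P. \<Sum>B\<in>P. \<Sum>C\<in>P. \<Sum>E\<in>P. g E C A B)"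
    for g :: "_ \<Rightarrow> _ \<Rightarrow> _ \<Rightarrow> _ \<Rightarrow> 'a"
  proof -
    have "(\<Sum>E\<in>P. \<Sum>C\<in>P. \<Sum>A\<in>P. \<Sum>B\<in>P. g E C A B) = (\<Sum>C\<in>P. \<Sum>E\<in>P. \<Sum>A\<in>P. \<Sum>B\<in>P. g E C A B)"
      by (rule sum.swap)
    also have "\<dots> = (\<Sum>C\<in>P. \<Sum>A\<in>P. \<Sum>E\<in>P. \<Sum>B\<in>P. g E C A B)"
      by (rule sum.cong, rule refl, rule sum.swap)
    also have "\<dots> = (\<Sum>A\<in>P. \<Sum>C\<in>P. \<Sum>E\<in>P. \<Sum>B\<in>P. g E C A B)"
      by (rule sum.swap)
    also have "\<dots> = (\<Sum>A\<in>P. \<Sum>C\<in>P. \<Sum>B\<in>P. \<Sum>E\<in>P. g E C A B)"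
      by (rule sum.cong, rule refl, rule sum.cong, rule refl, rule sum.swap)
    also have "\<dots> = (\<Sum>A\<in>P. \<Sum>B\<in>P. \<Sum>C\<in>P. \<Sum>E\<in>P. g E C A B)"
      by (rule sum.cong, rule refl, rule sum.swap)
    finally show ?thesis .
  qed
  have swap3': "(\<Sum>A\<in>P. \<Sum>E\<in>P. \<Sum>B\<in>P. \<Sum>C\<in>P. g E C A B) = (\<Sum>A\<in>P. \<Sum>B\<in>P. \<Sum>C\<in>P. \<Sum>E\<in>P. g E C A B)"
    for g :: "_ \<Rightarrow> _ \<Rightarrow> _ \<Rightarrow> _ \<Rightarrow> 'a"
  proof -
    have "(\<Sum>A\<in>P. \<Sum>E\<in>P. \<Sum>B\<in>P. \<Sum>C\<in>P. g E C A B) = (\<Sum>A\<in>P. \<Sum>B\<in>P. \<Sum>E\<in>P. \<Sum>C\<in>P. g E C A B)"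
      by (rule sum.cong, rule refl, rule sum.swap)
    also have "\<dots> = (\<Sum>A\<in>P. \<Sum>B\<in>P. \<Sum>C\<in>P. \<Sum>E\<in>P. g E C A B)"
      by (rule sum.cong, rule refl, rule sum.cong, rule refl, rule sum.swap)
    finally show ?thesis .
  qed
  have "cl_mult p q r (cl_mult p q r x y) z D =
      (\<Sum>E\<in>P. \<Sum>C\<in>P. \<Sum>A\<in>P. \<Sum>B\<in>P. if sym_diff A B = E then if sym_diff E C = D
        then cl_coeff p q E C * (cl_coeff p q A B * x A * y B) * z C else 0 else 0)"
    unfolding cl_mult_def P_def[symmetric]
  proof (intro sum.cong[OF refl])
    fix E C
    show "(if sym_diff E C = D then cl_coeff p q E C *
            (\<Sum>A\<in>P. \<Sum>B\<in>P. if sym_diff A B = E then cl_coeff p q A B * x A * y B else 0) * z C else 0) =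
      (\<Sum>A\<in>P. \<Sum>B\<in>P. if sym_diff A B = E then if sym_diff E C = D
        then cl_coeff p q E C * (cl_coeff p q A B * x A * y B) * z C else 0 else 0)"
      by (cases "sym_diff E C = D")
         (simp_all only: simp_thms if_True if_False sum_distrib_left sum_distrib_right if_cancel sum.neutral_const
           if_distrib[of "\<lambda>t. t * _"] if_distrib[of "\<lambda>t. _ * t"] mult_zero_left mult_zero_right)
  qed
  also have "\<dots> = (\<Sum>A\<in>P. \<Sum>B\<in>P. \<Sum>C\<in>P. \<Sum>E\<in>P. if sym_diff A B = E then if sym_diff E C = D
        then cl_coeff p q E C * (cl_coeff p q A B * x A * y B) * z C else 0 else 0)"
    by (rule swap3)
  also have "\<dots> = (\<Sum>A\<in>P. \<Sum>B\<in>P. \<Sum>C\<in>P. if sym_diff (sym_diff A B) C = D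
        then cl_coeff p q (sym_diff A B) C * (cl_coeff p q A B * x A * y B) * z C else 0)"
    by (intro sum.cong refl) (simp only: sum.delta'[OF fin(1)] P if_True)
  also have "\<dots> = (\<Sum>A\<in>P. \<Sum>B\<in>P. \<Sum>C\<in>P. if sym_diff A (sym_diff B C) = D
        then cl_coeff p q A (sym_diff B C) * x A * (cl_coeff p q B C * y B * z C) else 0)"
  proof (intro sum.cong refl)
    fix A B C assume "A \<in> P" "B \<in> P" "C \<in> P"
    then have "cl_coeff p q (sym_diff A B) C * cl_coeff p q A B * (x A * y B * z C) =
         cl_coeff p q A (sym_diff B C) * cl_coeff p q B C * (x A * y B * z C)"
      by (simp only: cl_coeff_assoc fin)
    then have "cl_coeff p q (sym_diff A B) C * (cl_coeff p q A B * x A * y B) * z C =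
         cl_coeff p q A (sym_diff B C) * x A * (cl_coeff p q B C * y B * z C)"
      by (simp only: mult_ac)
    then show "(if sym_diff (sym_diff A B) C = D
        then cl_coeff p q (sym_diff A B) C * (cl_coeff p q A B * x A * y B) * z C else 0) =
      (if sym_diff A (sym_diff B C) = D
        then cl_coeff p q A (sym_diff B C) * x A * (cl_coeff p q B C * y B * z C) else 0)"
      by (simp only: sd)
  qed
  also have "\<dots> = (\<Sum>A\<in>P. \<Sum>B\<in>P. \<Sum>C\<in>P. \<Sum>E\<in>P. if sym_diff B C = E then if sym_diff A E = D
        then cl_coeff p q A E * x A * (cl_coeff p q B C * y B * z C) else 0 else 0)"
    by (intro sum.cong refl) (simp only: sum.delta'[OF fin(1)] P if_True)
  also have "\<dots> = (\<Sum>A\<in>P. \<Sum>E\<in>P. \<Sum>B\<in>P. \<Sum>C\<in>P. if sym_diff B C = E then if sym_diff A E = D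
        then cl_coeff p q A E * x A * (cl_coeff p q B C * y B * z C) else 0 else 0)"
    by (rule swap3'[symmetric])
  also have "\<dots> = cl_mult p q r x (cl_mult p q r y z) D"
    unfolding cl_mult_def P_def[symmetric]
  proof (intro sum.cong[OF refl])
    fix A E
    show "(\<Sum>B\<in>P. \<Sum>C\<in>P. if sym_diff B C = E then if sym_diff A E = D
        then cl_coeff p q A E * x A * (cl_coeff p q B C * y B * z C) else 0 else 0) =
      (if sym_diff A E = D then cl_coeff p q A E * x A *
        (\<Sum>B\<in>P. \<Sum>C\<in>P. if sym_diff B C = E then cl_coeff p q B C * y B * z C else 0) else 0)"
      by (cases "sym_diff A E = D")
         (simp_all only: simp_thms if_True if_False sum_distrib_left if_cancel sum.neutral_const
           if_distrib[of "\<lambda>t. _ * t"] mult_zero_right)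
  qed
  finally show "cl_mult p q r (cl_mult p q r x y) z D = cl_mult p q r x (cl_mult p q r y z) D" .
qed

lemma cl_mult_one:
  assumes "x \<in> carrier (Cl p q r)"
  shows "cl_mult p q r (cl_basis {}) x = x" "cl_mult p q r x (cl_basis {}) = x"
proof -
  let ?P = "Pow {1..p+q+r}"
  have fin: "finite ?P" by simp
  have "cl_mult p q r (cl_basis {}) x C = x C" for C
  proof -
    have "cl_mult p q r (cl_basis {}) x C =
        (\<Sum>A\<in>?P. if A = {} then \<Sum>B\<in>?P. if B = C then x B else 0 else 0)"
      unfolding cl_mult_def cl_basis_def
      by (rule sum.cong[OF refl]) (simp cong: if_cong)
    also have "\<dots> = x C"
      using assms by (auto simp: sum.delta[OF fin] Cl_simps)
    finally show ?thesis .
  qed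
  then show "cl_mult p q r (cl_basis {}) x = x" by auto
  have "cl_mult p q r x (cl_basis {}) C = x C" for C
  proof -
    have "cl_mult p q r x (cl_basis {}) C =
        (\<Sum>A\<in>?P. \<Sum>B\<in>?P. if B = {} then if A = C then x A else 0 else 0)"
      unfolding cl_mult_def cl_basis_def by (intro sum.cong refl) simp
    also have "\<dots> = x C"
      using assms by (auto simp: sum.delta[OF fin] Cl_simps)
    finally show ?thesis .
  qed
  then show "cl_mult p q r x (cl_basis {}) = x" by auto
qed

lemma cl_mult_add:
  "cl_mult p q r (\<lambda>A. x A + y A) z = (\<lambda>A. cl_mult p q r x z A + cl_mult p q r y z A)"
  "cl_mult p q r z (\<lambda>A. x A + y A) = (\<lambda>A. cl_mult p q r z x A + cl_mult p q r z y A)"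
  unfolding cl_mult_def
  by (auto simp: fun_eq_iff sum.distrib[symmetric] algebra_simps intro!: sum.cong)

lemma ring_Cl: "ring (Cl p q r :: 'a::field multivector ring)"
proof (rule ringI)
  show "abelian_group (Cl p q r :: 'a multivector ring)"
  proof (rule abelian_groupI)
    fix x :: "'a multivector" assume x: "x \<in> carrier (Cl p q r)"
    show "\<exists>y\<in>carrier (Cl p q r). y \<oplus>\<^bsub>Cl p q r\<^esub> x = \<zero>\<^bsub>Cl p q r\<^esub>"
      using x by (intro bexI[of _ "\<lambda>A. - x A"]) (auto simp: Cl_simps)
  next
    fix x y :: "'a multivector" assume "x \<in> carrier (Cl p q r)" "y \<in> carrier (Cl p q r)"
    then show "x \<oplus>\<^bsub>Cl p q r\<^esub> y \<in> carrier (Cl p q r)"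
      unfolding Cl_simps by (metis add_0)
  qed (simp_all add: Cl_simps add_ac)
  show "Group.monoid (Cl p q r :: 'a multivector ring)"
  proof (rule monoidI)
    show "\<one>\<^bsub>Cl p q r\<^esub> \<in> carrier (Cl p q r :: 'a multivector ring)"
      by (auto simp: Cl_simps cl_basis_def split: if_splits)
  qed (auto simp: Cl_simps(2,3) cl_mult_closed cl_mult_assoc cl_mult_one)
qed (simp_all add: Cl_simps(2,5) cl_mult_add)

subsection \<open>Generators and basis\<close>

lemma cl_mult_basis:
  assumes "A \<subseteq> {1..p+q+r}" "B \<subseteq> {1..p+q+r}"
  shows "cl_mult p q r (cl_basis A :: 'a::field multivector) (cl_basis B) = cl_smult (cl_coeff p q A B) (cl_basis (sym_diff A B))"
proof
  fix C
  let ?P = "Pow {1..p+q+r}"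
  have fin: "finite ?P" by simp
  have "cl_mult p q r (cl_basis A :: 'a multivector) (cl_basis B) C =
      (\<Sum>A'\<in>?P. if A' = A then \<Sum>B'\<in>?P. if B' = B then
         if sym_diff A' B' = C then cl_coeff p q A' B' else 0 else 0 else 0)"
    unfolding cl_mult_def cl_basis_def
  proof (rule sum.cong[OF refl])
    fix A'
    show "(\<Sum>B'\<in>?P. if sym_diff A' B' = C
            then cl_coeff p q A' B' * (if A' = A then 1 else 0) * (if B' = B then 1 else 0) else 0) =
      (if A' = A then \<Sum>B'\<in>?P. if B' = B then
         if sym_diff A' B' = C then cl_coeff p q A' B' else 0 else 0 else 0)"
    proof (cases "A' = A")
      case True
      then show ?thesis by (simp only: simp_thms if_True) (intro sum.cong refl, simp)
    next
      case False
      then show ?thesis by (simp cong: if_cong)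
    qed
  qed
  also have "\<dots> = (if sym_diff A B = C then cl_coeff p q A B else 0)"
    using assms by (simp only: sum.delta[OF fin] Pow_iff if_True)
  finally show "cl_mult p q r (cl_basis A :: 'a multivector) (cl_basis B) C =
      cl_smult (cl_coeff p q A B) (cl_basis (sym_diff A B)) C"
    by (simp add: cl_smult_def cl_basis_def eq_commute[of C])
qed

lemma cl_gen_relation:
  assumes "a \<in> {1..p+q+r}" "b \<in> {1..p+q+r}"
  shows "cl_gen a \<otimes>\<^bsub>Cl p q r\<^esub> cl_gen b \<oplus>\<^bsub>Cl p q r\<^esub> cl_gen b \<otimes>\<^bsub>Cl p q r\<^esub> cl_gen a =
         cl_smult (2 * (if a = b then cl_eta p q a else 0)) \<one>\<^bsub>Cl p q r\<^esub>"
  using assms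
  by (cases a b rule: linorder_cases)
     (auto simp: Cl_simps cl_gen_def cl_mult_basis cl_smult_def cl_coeff_def insert_commute
        algebra_simps insert_Diff_if)

lemma cl_basis_eq_ordered_product:
  assumes "A \<subseteq> {1..p+q+r}"
  shows "(cl_basis A :: 'a::field multivector) =
         foldr (mult (Cl p q r)) (map cl_gen (sorted_list_of_set A)) \<one>\<^bsub>Cl p q r\<^esub>"
proof -
  have "foldr (mult (Cl p q r)) (map cl_gen xs) \<one>\<^bsub>Cl p q r\<^esub> = (cl_basis (set xs) :: 'a multivector)"
    if "sorted_wrt (<) xs" "set xs \<subseteq> {1..p+q+r}" for xs
    using that
  proof (induction xs)
    case Nil
    then show ?case by (simp add: Cl_simps)
  next
    case (Cons a xs)
    have a: "\<forall>b\<in>set xs. a < b" and IH: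
      "foldr (mult (Cl p q r)) (map cl_gen xs) \<one>\<^bsub>Cl p q r\<^esub> = (cl_basis (set xs) :: 'a multivector)"
      using Cons by auto
    have "cl_coeff p q {a} (set xs) = (1::'a)"
    proof -
      have "{a} \<inter> set xs = {}" using a by auto
      moreover have "(\<Prod>b\<in>set xs. if b < a then -1 else (1::'a)) = 1"
        using a by (intro prod.neutral) auto
      ultimately show ?thesis by (simp add: cl_coeff_def)
    qed
    moreover have "sym_diff {a} (set xs) = insert a (set xs)"
      using a by auto
    ultimately show ?case
      using Cons.prems
      by (simp add: IH) (simp add: Cl_simps(2) cl_gen_def cl_mult_basis cl_smult_def)
  qed
  from this[of "sorted_list_of_set A"] assms finite_subset[OF assms] show ?thesis
    by simp
qed

lemma cl_basis_expansion:
  assumes "x \<in> carrier (Cl p q r)"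
  shows "x = (\<lambda>B. \<Sum>A\<in>Pow {1..p+q+r}. cl_smult (x A) (cl_basis A) B)"
  using assms by (auto simp: fun_eq_iff cl_smult_def cl_basis_def Cl_simps if_distrib[of "(*) _"] cong: if_cong)

section \<open>Grades, involutions, and distinguished subspaces\<close>

definition cl_grade :: "nat \<Rightarrow> nat \<Rightarrow> nat \<Rightarrow> nat \<Rightarrow> 'a::field multivector set" where
  "cl_grade p q r k = {x \<in> carrier (Cl p q r). \<forall>A. x A \<noteq> 0 \<longrightarrow> card A = k}"

text \<open>\<open>cl_grade\<close> is the span of the ordered products of \<open>k\<close> generators.\<close>

lemma cl_grade_iff_span:
  "x \<in> cl_grade p q r k \<longleftrightarrow>
   (\<exists>c. x = (\<lambda>B. \<Sum>A | A \<subseteq> {1..p+q+r} \<and> card A = k. cl_smult (c A) (cl_basis A) B))"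
proof
  assume "x \<in> cl_grade p q r k"
  then show "\<exists>c. x = (\<lambda>B. \<Sum>A | A \<subseteq> {1..p+q+r} \<and> card A = k. cl_smult (c A) (cl_basis A) B)"
    by (intro exI[of _ x])
      (auto simp: fun_eq_iff cl_grade_def Cl_simps cl_smult_def cl_basis_def if_distrib[of "(*) _"]
        cong: if_cong)
next
  assume "\<exists>c. x = (\<lambda>B. \<Sum>A | A \<subseteq> {1..p+q+r} \<and> card A = k. cl_smult (c A) (cl_basis A) B)"
  then show "x \<in> cl_grade p q r k"
    by (auto simp: cl_grade_def Cl_simps cl_smult_def cl_basis_def split: if_splits
        elim!: sum.not_neutral_contains_not_neutral)
qed

definition cl_even :: "nat \<Rightarrow> nat \<Rightarrow> nat \<Rightarrow> 'a::field multivector set" where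
  "cl_even p q r = {x \<in> carrier (Cl p q r). \<forall>A. x A \<noteq> 0 \<longrightarrow> even (card A)}"

definition cl_hat :: "'a::field multivector \<Rightarrow> 'a multivector" where
  "cl_hat x = (\<lambda>A. (-1) ^ card A * x A)"

definition cl_rev :: "'a::field multivector \<Rightarrow> 'a multivector" where
  "cl_rev x = (\<lambda>A. (-1) ^ (card A * (card A - 1) div 2) * x A)"

definition cl_conj :: "'a::field multivector \<Rightarrow> 'a multivector" where
  "cl_conj x = cl_hat (cl_rev x)"

text \<open>The unital subalgebra generated by the null generators:\<close>

inductive_set cl_Lambda :: "nat \<Rightarrow> nat \<Rightarrow> nat \<Rightarrow> 'a::field multivector set" for p q r where
  one: "\<one>\<^bsub>Cl p q r\<^esub> \<in> cl_Lambda p q r"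
| gen: "i \<in> {p+q+1..p+q+r} \<Longrightarrow> cl_gen i \<in> cl_Lambda p q r"
| smult: "x \<in> cl_Lambda p q r \<Longrightarrow> cl_smult c x \<in> cl_Lambda p q r"
| add: "x \<in> cl_Lambda p q r \<Longrightarrow> y \<in> cl_Lambda p q r \<Longrightarrow> x \<oplus>\<^bsub>Cl p q r\<^esub> y \<in> cl_Lambda p q r"
| mult: "x \<in> cl_Lambda p q r \<Longrightarrow> y \<in> cl_Lambda p q r \<Longrightarrow> x \<otimes>\<^bsub>Cl p q r\<^esub> y \<in> cl_Lambda p q r"

lemma cl_Lambda_eq: "cl_Lambda p q r = {x. \<forall>A. x A \<noteq> 0 \<longrightarrow> A \<subseteq> {p+q+1..p+q+r}}"
proof (intro equalityI subsetI CollectI)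
  fix x :: "'a multivector" assume "x \<in> cl_Lambda p q r"
  then show "\<forall>A. x A \<noteq> 0 \<longrightarrow> A \<subseteq> {p+q+1..p+q+r}"
  proof induction
    case (add x y)
    then show ?case by (metis Cl_simps(5) add_0)
  next
    case (mult x y)
    show ?case
    proof (intro allI impI)
      fix C assume "(x \<otimes>\<^bsub>Cl p q r\<^esub> y) C \<noteq> 0"
      then obtain A B where "(if sym_diff A B = C then cl_coeff p q A B * x A * y B else 0) \<noteq> 0"
        unfolding Cl_simps cl_mult_def by (elim sum.not_neutral_contains_not_neutral)
      then have "sym_diff A B = C" "x A \<noteq> 0" "y B \<noteq> 0" by (auto split: if_splits)
      then show "C \<subseteq> {p+q+1..p+q+r}" using mult.IH by blast
    qed
  qed (auto simp: Cl_simps cl_basis_def cl_gen_def cl_smult_def split: if_splits)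
next
  fix x :: "'a multivector" assume "x \<in> {x. \<forall>A. x A \<noteq> 0 \<longrightarrow> A \<subseteq> {p+q+1..p+q+r}}"
  then have x: "A \<subseteq> {p+q+1..p+q+r}" if "x A \<noteq> 0" for A using that by auto
  let ?N = "Pow {p+q+1..p+q+r}"
  have list: "foldr (mult (Cl p q r)) (map cl_gen xs) \<one>\<^bsub>Cl p q r\<^esub> \<in> (cl_Lambda p q r :: 'a multivector set)"
    if "set xs \<subseteq> {p+q+1..p+q+r}" for xs
    using that
  proof (induction xs)
    case (Cons a xs)
    then have "cl_gen a \<in> cl_Lambda p q r"
      "foldr (mult (Cl p q r)) (map cl_gen xs) \<one>\<^bsub>Cl p q r\<^esub> \<in> (cl_Lambda p q r :: 'a multivector set)"
      by (auto simp del: atLeastAtMost_iff intro: cl_Lambda.gen)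
    then have "cl_gen a \<otimes>\<^bsub>Cl p q r\<^esub> foldr (mult (Cl p q r)) (map cl_gen xs) \<one>\<^bsub>Cl p q r\<^esub>
        \<in> (cl_Lambda p q r :: 'a multivector set)"
      by (rule cl_Lambda.mult)
    then show ?case by simp
  qed (simp add: cl_Lambda.one)
  have basis: "(cl_basis A :: 'a multivector) \<in> cl_Lambda p q r" if "A \<in> ?N" for A
  proof -
    have "A \<subseteq> {1..p+q+r}" "finite A" using that by (auto intro: finite_subset)
    then show ?thesis
      using list[of "sorted_list_of_set A"] that by (subst cl_basis_eq_ordered_product) auto
  qed
  have zero: "(\<lambda>B. 0::'a) \<in> cl_Lambda p q r"
    using cl_Lambda.smult[OF cl_Lambda.one, of 0] by (simp add: cl_smult_def)
  have sum: "(\<lambda>B. \<Sum>A\<in>S. cl_smult (x A) (cl_basis A) B) \<in> cl_Lambda p q r"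
    if "finite S" "S \<subseteq> ?N" for S
    using that
  proof (induction S rule: finite_induct)
    case (insert A S)
    then have "cl_smult (x A) (cl_basis A) \<oplus>\<^bsub>Cl p q r\<^esub> (\<lambda>B. \<Sum>A\<in>S. cl_smult (x A) (cl_basis A) B)
        \<in> cl_Lambda p q r"
      by (intro cl_Lambda.add cl_Lambda.smult basis) auto
    with insert show ?case by (simp add: Cl_simps)
  qed (simp add: zero)
  have "x = (\<lambda>B. \<Sum>A\<in>?N. cl_smult (x A) (cl_basis A) B)"
    using x by (auto simp: fun_eq_iff cl_smult_def cl_basis_def if_distrib[of "(*) _"] cong: if_cong)
  with sum[of ?N] show "x \<in> cl_Lambda p q r" by simp
qed

definition cl_Lambda_even :: "nat \<Rightarrow> nat \<Rightarrow> nat \<Rightarrow> 'a::field multivector set" where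
  "cl_Lambda_even p q r = cl_Lambda p q r \<inter> cl_even p q r"

text \<open>
  The elements of \<open>H\<close> that are invertible in the whole algebra; when \<open>H\<close> is a unital subalgebra, the
  inverse lies in \<open>H\<close> automatically, since the algebra is finite-dimensional.
\<close>

definition cl_invertible :: "nat \<Rightarrow> nat \<Rightarrow> nat \<Rightarrow> 'a::field multivector set \<Rightarrow> 'a multivector set" where
  "cl_invertible p q r H = H \<inter> Units (Cl p q r)"

section \<open>Centralizers and groups\<close>

definition cl_center :: "nat \<Rightarrow> nat \<Rightarrow> nat \<Rightarrow> 'a::field multivector set" where
  "cl_center p q r = {X \<in> carrier (Cl p q r). \<forall>V\<in>carrier (Cl p q r).
     X \<otimes>\<^bsub>Cl p q r\<^esub> V = V \<otimes>\<^bsub>Cl p q r\<^esub> X}"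

definition cl_Z :: "nat \<Rightarrow> nat \<Rightarrow> nat \<Rightarrow> nat \<Rightarrow> 'a::field multivector set" where
  "cl_Z p q r m = {X \<in> carrier (Cl p q r). \<forall>V\<in>cl_grade p q r m.
     X \<otimes>\<^bsub>Cl p q r\<^esub> V = V \<otimes>\<^bsub>Cl p q r\<^esub> X}"

definition cl_twisted_Z :: "nat \<Rightarrow> nat \<Rightarrow> nat \<Rightarrow> nat \<Rightarrow> 'a::field multivector set" where
  "cl_twisted_Z p q r m = {X \<in> carrier (Cl p q r). \<forall>V\<in>cl_grade p q r m.
     cl_hat X \<otimes>\<^bsub>Cl p q r\<^esub> V = V \<otimes>\<^bsub>Cl p q r\<^esub> X}"

definition cl_B12 :: "nat \<Rightarrow> nat \<Rightarrow> nat \<Rightarrow> 'a::field multivector set" where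
  "cl_B12 p q r = {T \<in> Units (Cl p q r). cl_conj T \<otimes>\<^bsub>Cl p q r\<^esub> T \<in> cl_invertible p q r (cl_Z p q r 1)}"

definition cl_B03 :: "nat \<Rightarrow> nat \<Rightarrow> nat \<Rightarrow> 'a::field multivector set" where
  "cl_B03 p q r = {T \<in> Units (Cl p q r). cl_conj T \<otimes>\<^bsub>Cl p q r\<^esub> T \<in> cl_invertible p q r (cl_Z p q r 3)}"

definition cl_twisted_B23 :: "nat \<Rightarrow> nat \<Rightarrow> nat \<Rightarrow> 'a::field multivector set" where
  "cl_twisted_B23 p q r = {T \<in> Units (Cl p q r). cl_conj T \<otimes>\<^bsub>Cl p q r\<^esub> T \<in>
     cl_invertible p q r (cl_twisted_Z p q r 2 \<inter> cl_twisted_Z p q r 3)}"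

definition cl_twisted_B :: "nat \<Rightarrow> nat \<Rightarrow> nat \<Rightarrow> 'a::field multivector set" where
  "cl_twisted_B p q r = {T \<in> Units (Cl p q r). cl_conj T \<otimes>\<^bsub>Cl p q r\<^esub> T \<in>
     cl_invertible p q r (cl_Lambda_even p q r)}"

end

theory Submission
  imports Defs
begin

text \<open>
  Write \<open>T\<^sup>*\<close> for the Clifford conjugate of \<open>T\<close> and call \<open>N(T) = T\<^sup>* T\<close> its norm. Each of the three groups on
  the left-hand sides consists of the invertible \<open>T\<close> whose norm lies in some subspace \<open>H\<close>: the center,
  the intersection of the twisted centralizers of grades 2 and 3, or the centralizer of grade 3. All
  three are unital subalgebras that are stable under conjugation and contain the even part of \<open>\<Lambda>\<^sub>r\<close>, and the proof treats
  them uniformly (lemma \<open>cl_norm_group_factorization\<close>).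

  The inclusion of the product in the group is a computation: if \<open>N(g)\<close> is an even Grassmann element and
  \<open>h \<in> H\<close>, then \<open>N(g h) = h\<^sup>* N(g) h\<close> is a product of elements of \<open>H\<close>.

  For the other inclusion, a norm is fixed by conjugation, so its components have grades congruent to
  0 or 3 modulo 4. Hence a basis element \<open>e\<^sub>A\<close> that occurs in \<open>N(T)\<close>, with \<open>A\<close> nonempty, is a product of at
  least three generators. If none of them were null, the commutation rules with suitable products of three
  generators would show that \<open>e\<^sub>A\<close> cannot occur in an element of \<open>H\<close>. Therefore \<open>N(T) = c + x\<close> with a scalar \<open>c\<close>
  and an \<open>x\<close> in the ideal \<open>J\<close> generated by the null generators. This ideal is nilpotent, so \<open>c \<noteq> 0\<close>, and
  the inverse square root of \<open>1 + x/c\<close> exists: it is an invertible \<open>h \<in> H\<close> with \<open>h\<^sup>* N(T) h = c\<close>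
  (lemma \<open>cl_scalar_plus_null_congruent_scalar\<close>). Now \<open>g = T h\<close> has the scalar norm \<open>c\<close>, an even element of \<open>\<Lambda>\<^sub>r\<close>, and
  \<open>T = g h\<inverse>\<close> is the required factorization. So the first factor can even be chosen with scalar norm.
\<close>

section \<open>Structure constants\<close>

text \<open>
  Of the two sorting signs for a pair \<open>(a, b)\<close>, exactly one is \<open>-1\<close> if \<open>a \<noteq> b\<close>, and none if \<open>a = b\<close>; the
  exponent counts the pairs of the first kind modulo 2.
\<close>

lemma cl_coeff_swap:
  assumes "finite A" "finite B"
  shows "cl_coeff p q B A = (-1) ^ (card A * card B + card (A \<inter> B)) * (cl_coeff p q A B :: 'a::field)"
proof -
  have "(\<Prod>b\<in>B. \<Prod>a\<in>A. if a < b then -1 else (1::'a)) =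
        (\<Prod>a\<in>A. \<Prod>b\<in>B. (-1) * ((if b < a then -1 else 1) * (if a = b then -1 else 1)))"
    by (subst prod.swap) (intro prod.cong refl, auto)
  also have "\<dots> = (-1) ^ (card A * card B) * ((\<Prod>a\<in>A. \<Prod>b\<in>B. if b < a then -1 else 1) *
                 (\<Prod>a\<in>A. \<Prod>b\<in>B. if a = b then -1 else 1))"
    by (simp only: prod.distrib prod_constant power_mult[symmetric] mult.commute[of "card A"])
  also have "(\<Prod>a\<in>A. \<Prod>b\<in>B. if a = b then -1 else 1) = (\<Prod>a\<in>A. if a \<in> B then -1 else (1::'a))"
    using assms by (simp add: prod.delta)
  also have "\<dots> = (-1) ^ card (A \<inter> B)"
    by (simp add: prod.inter_restrict[OF assms(1), symmetric])
  finally show ?thesis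
    by (simp add: cl_coeff_def Int_commute power_add mult_ac)
qed

lemma cl_coeff_eq_0_iff:
  assumes "A \<subseteq> {1..p+q+r}"
  shows "(cl_coeff p q A B :: 'a::field) = 0 \<longleftrightarrow> A \<inter> B \<inter> {p+q+1..p+q+r} \<noteq> {}"
proof -
  have fin: "finite A" using assms finite_subset by blast
  have "(\<Prod>b\<in>B. if b < a then -1 else (1::'a)) \<noteq> 0" for a :: nat
    by (cases "finite B") auto
  then have "(cl_coeff p q A B :: 'a) = 0 \<longleftrightarrow> (\<exists>i\<in>A \<inter> B. \<not> i \<le> p + q)"
    using fin by (auto simp: cl_coeff_def cl_eta_def)
  also have "\<dots> \<longleftrightarrow> A \<inter> B \<inter> {p+q+1..p+q+r} \<noteq> {}"
  proof -
    have "\<not> i \<le> p + q \<longleftrightarrow> i \<in> {p+q+1..p+q+r}" if "i \<in> A" for i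
      using subsetD[OF assms that] by auto
    then show ?thesis by blast
  qed
  finally show ?thesis .
qed

lemma cl_mult_nonzeroE:
  fixes x y :: "'a::field multivector"
  assumes "cl_mult p q r x y C \<noteq> 0"
  obtains A B where "A \<subseteq> {1..p+q+r}" "B \<subseteq> {1..p+q+r}" "C = sym_diff A B"
    "x A \<noteq> 0" "y B \<noteq> 0" "(cl_coeff p q A B :: 'a) \<noteq> 0"
proof -
  from assms obtain A B where "A \<in> Pow {1..p+q+r}" "B \<in> Pow {1..p+q+r}"
    "(if sym_diff A B = C then cl_coeff p q A B * x A * y B else 0) \<noteq> 0"
    unfolding cl_mult_def by (elim sum.not_neutral_contains_not_neutral)
  with that show ?thesis by (auto split: if_splits)
qed

lemma cl_mult_smult:
  "cl_mult p q r (cl_smult c x) y = cl_smult c (cl_mult p q r x y)"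
  "cl_mult p q r x (cl_smult c y) = cl_smult c (cl_mult p q r x y)"
  unfolding cl_mult_def cl_smult_def
  by (auto simp: fun_eq_iff sum_distrib_left mult_ac intro!: sum.cong)

text \<open>
  For fixed \<open>B\<close> the map \<open>A \<mapsto> sym_diff A B\<close> is injective, so the terms of \<open>x e\<^sub>B\<close> do not interfere. An
  equation such as \<open>x e\<^sub>B = e\<^sub>B x\<close> can thus be tested on each coordinate of \<open>x\<close> separately.
\<close>

lemma cl_mult_basis_at:
  assumes "A \<subseteq> {1..p+q+r}" "B \<subseteq> {1..p+q+r}"
  shows "cl_mult p q r x (cl_basis B) (sym_diff A B) = cl_coeff p q A B * (x A :: 'a::field)"
    and "cl_mult p q r (cl_basis B) x (sym_diff A B) = cl_coeff p q B A * x A"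
proof -
  let ?P = "Pow {1..p+q+r}"
  have fin: "finite ?P" by simp
  have eq: "sym_diff A' B = sym_diff A B \<longleftrightarrow> A' = A" "sym_diff B A' = sym_diff A B \<longleftrightarrow> A' = A" for A'
    by blast+
  have "cl_mult p q r x (cl_basis B) (sym_diff A B) =
      (\<Sum>A'\<in>?P. if A' = A then \<Sum>B'\<in>?P. if B' = B then cl_coeff p q A B * x A else 0 else 0)"
    unfolding cl_mult_def cl_basis_def
  proof (rule sum.cong[OF refl])
    fix A'
    have "(\<Sum>B'\<in>?P. if sym_diff A' B' = sym_diff A B
            then cl_coeff p q A' B' * x A' * (if B' = B then 1 else 0) else 0) =
          (\<Sum>B'\<in>?P. if B' = B then if A' = A then cl_coeff p q A B * x A else 0 else 0)"
      by (rule sum.cong[OF refl]) (simp add: eq)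
    then show "(\<Sum>B'\<in>?P. if sym_diff A' B' = sym_diff A B
            then cl_coeff p q A' B' * x A' * (if B' = B then 1 else 0) else 0) =
      (if A' = A then \<Sum>B'\<in>?P. if B' = B then cl_coeff p q A B * x A else 0 else 0)"
      by (simp cong: if_cong)
  qed
  also have "\<dots> = cl_coeff p q A B * x A"
    using assms by (simp only: sum.delta[OF fin] Pow_iff if_True)
  finally show "cl_mult p q r x (cl_basis B) (sym_diff A B) = cl_coeff p q A B * x A" .
  have "cl_mult p q r (cl_basis B) x (sym_diff A B) =
      (\<Sum>B'\<in>?P. if B' = B then \<Sum>A'\<in>?P. if A' = A then cl_coeff p q B A * x A else 0 else 0)"
    unfolding cl_mult_def cl_basis_def
  proof (rule sum.cong[OF refl])
    fix B'
    have "(\<Sum>A'\<in>?P. if sym_diff B' A' = sym_diff A B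
            then cl_coeff p q B' A' * (if B' = B then 1 else 0) * x A' else 0) =
          (\<Sum>A'\<in>?P. if A' = A then if B' = B then cl_coeff p q B A * x A else 0 else 0)"
      by (rule sum.cong[OF refl]) (auto simp: eq)
    then show "(\<Sum>A'\<in>?P. if sym_diff B' A' = sym_diff A B
            then cl_coeff p q B' A' * (if B' = B then 1 else 0) * x A' else 0) =
      (if B' = B then \<Sum>A'\<in>?P. if A' = A then cl_coeff p q B A * x A else 0 else 0)"
      by (simp cong: if_cong)
  qed
  also have "\<dots> = cl_coeff p q B A * x A"
    using assms by (simp only: sum.delta[OF fin] Pow_iff if_True)
  finally show "cl_mult p q r (cl_basis B) x (sym_diff A B) = cl_coeff p q B A * x A" .
qed

lemma cl_mult_commuteI:
  fixes x y :: "'a::field multivector"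
  assumes "\<And>A B. A \<subseteq> {1..p+q+r} \<Longrightarrow> B \<subseteq> {1..p+q+r} \<Longrightarrow> x A \<noteq> 0 \<Longrightarrow> y B \<noteq> 0 \<Longrightarrow>
             cl_coeff p q A B = (cl_coeff p q B A :: 'a)"
  shows "cl_mult p q r x y = cl_mult p q r y x"
proof
  fix C
  have "cl_mult p q r y x C = (\<Sum>A\<in>Pow {1..p+q+r}. \<Sum>B\<in>Pow {1..p+q+r}.
     if sym_diff B A = C then cl_coeff p q B A * y B * x A else 0)"
    unfolding cl_mult_def by (rule sum.swap)
  also have "\<dots> = cl_mult p q r x y C"
    unfolding cl_mult_def
  proof (intro sum.cong refl)
    fix A B assume "A \<in> Pow {1..p+q+r}" "B \<in> Pow {1..p+q+r}"
    then have *: "cl_coeff p q B A * y B * x A = cl_coeff p q A B * x A * y B"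
      using assms[of A B] by (cases "x A = 0"; cases "y B = 0") simp_all
    show "(if sym_diff B A = C then cl_coeff p q B A * y B * x A else 0) =
       (if sym_diff A B = C then cl_coeff p q A B * x A * y B else 0)"
      by (simp only: * Un_commute)
  qed
  finally show "cl_mult p q r x y C = cl_mult p q r y x C" by simp
qed

section \<open>Grade involution and Clifford conjugation\<close>

lemma card_sym_diff_add:
  assumes "finite A" "finite B"
  shows "card (sym_diff A B) + 2 * card (A \<inter> B) = card A + card B"
proof -
  have "card (sym_diff A B) = card (A - B) + card (B - A)"
    using assms by (intro card_Un_disjoint) auto
  moreover have "card A = card (A - B) + card (A \<inter> B)" "card B = card (B - A) + card (A \<inter> B)"
    using assms card_Int_Diff[of A B] card_Int_Diff[of B A] by (auto simp: Int_commute)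
  ultimately show ?thesis by simp
qed

lemma minus_one_power_cong: "even (m + n) \<Longrightarrow> (-1 :: 'a::ring_1) ^ m = (-1) ^ n"
  by (auto simp: minus_one_power_iff)

definition cl_conj_sign :: "nat set \<Rightarrow> 'a::field" where
  "cl_conj_sign A = (-1) ^ (card A * (card A + 1) div 2)"

lemma cl_conj_apply: "cl_conj x A = cl_conj_sign A * x A"
proof -
  have "k * (k + 1) div 2 = k + k * (k - 1) div 2" for k :: nat
    by (cases k) (auto simp: algebra_simps)
  then show ?thesis by (simp only: cl_conj_def cl_hat_def cl_rev_def cl_conj_sign_def power_add mult.assoc)
qed

text \<open>
  This is the anti-automorphism property on basis elements. With \<open>a\<close>, \<open>b\<close>, \<open>i\<close> and \<open>d\<close> the cardinalities of
  \<open>A\<close>, \<open>B\<close>, \<open>A \<inter> B\<close> and the symmetric difference, it amounts to the congruence of triangular numbers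
  \<open>d(d+1)/2 + i \<equiv> a(a+1)/2 + b(b+1)/2 + a b\<close> modulo 2, which follows from \<open>d + 2 i = a + b\<close>.
\<close>

lemma cl_conj_sign_sym_diff:
  assumes "finite A" "finite B"
  shows "cl_conj_sign (sym_diff A B) * cl_coeff p q A B =
         cl_conj_sign A * cl_conj_sign B * (cl_coeff p q B A :: 'a::field)"
proof -
  define a b i d where "a = card A" "b = card B" "i = card (A \<inter> B)" "d = card (sym_diff A B)"
  have d: "d + 2 * i = a + b"
    unfolding a_b_i_d_def by (rule card_sym_diff_add) fact+
  have tri: "even (k * (k + 1))" for k :: nat by simp
  obtain ta tb td where t: "a * (a + 1) = 2 * ta" "b * (b + 1) = 2 * tb" "d * (d + 1) = 2 * td"
    using tri[of a] tri[of b] tri[of d] by (elim evenE)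
  have "2 * td + 4 * (i * d) + 4 * i ^ 2 + 2 * i = 2 * ta + 2 * tb + 2 * (a * b)"
  proof -
    have "(d + 2 * i) * (d + 2 * i + 1) = (a + b) * (a + b + 1)" by (simp only: d)
    then have "d * (d + 1) + 4 * (i * d) + 4 * i ^ 2 + 2 * i = a * (a + 1) + b * (b + 1) + 2 * (a * b)"
      by (simp add: algebra_simps power2_eq_square)
    then show ?thesis by (simp only: t)
  qed
  then have "td + i + 2 * (i * d + i ^ 2) = ta + tb + a * b" by simp
  then have "even (td + (ta + tb + (a * b + i)))" by presburger
  then have "(-1::'a) ^ td = (-1) ^ (ta + tb + (a * b + i))"
    by (rule minus_one_power_cong)
  then show ?thesis
    unfolding cl_conj_sign_def cl_coeff_swap[OF assms]
    by (simp only: a_b_i_d_def[symmetric] t power_add mult.assoc) simp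
qed

lemma cl_conj_mult: "cl_conj (cl_mult p q r x y) = cl_mult p q r (cl_conj y) (cl_conj x)"
proof
  fix C
  have "cl_mult p q r (cl_conj y) (cl_conj x) C = (\<Sum>A\<in>Pow {1..p+q+r}. \<Sum>B\<in>Pow {1..p+q+r}.
     if sym_diff B A = C then cl_coeff p q B A * cl_conj y B * cl_conj x A else 0)"
    unfolding cl_mult_def by (rule sum.swap)
  also have "\<dots> = (\<Sum>A\<in>Pow {1..p+q+r}. \<Sum>B\<in>Pow {1..p+q+r}.
     cl_conj_sign C * (if sym_diff A B = C then cl_coeff p q A B * x A * y B else 0))"
  proof (intro sum.cong refl)
    fix A B assume "A \<in> Pow {1..p+q+r}" "B \<in> Pow {1..p+q+r}"
    then have fin: "finite A" "finite B" by (auto intro: finite_subset)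
    have "cl_conj_sign (sym_diff A B) * cl_coeff p q A B * (x A * y B) =
          cl_conj_sign A * cl_conj_sign B * cl_coeff p q B A * (x A * y B)"
      by (simp only: cl_conj_sign_sym_diff[OF fin])
    then have *: "cl_conj_sign (sym_diff A B) * (cl_coeff p q A B * x A * y B) =
          cl_coeff p q B A * cl_conj y B * cl_conj x A"
      by (simp only: cl_conj_apply mult_ac)
    have "sym_diff B A = sym_diff A B" by blast
    then show "(if sym_diff B A = C then cl_coeff p q B A * cl_conj y B * cl_conj x A else 0) =
      cl_conj_sign C * (if sym_diff A B = C then cl_coeff p q A B * x A * y B else 0)"
      using * by auto
  qed
  also have "\<dots> = cl_conj (cl_mult p q r x y) C"
    by (simp only: cl_conj_apply cl_mult_def sum_distrib_left)
  finally show "cl_conj (cl_mult p q r x y) C = cl_mult p q r (cl_conj y) (cl_conj x) C" by simp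
qed

lemma cl_hat_mult: "cl_hat (cl_mult p q r x y) = cl_mult p q r (cl_hat x) (cl_hat y)"
proof
  fix C
  show "cl_hat (cl_mult p q r x y) C = cl_mult p q r (cl_hat x) (cl_hat y) C"
    unfolding cl_hat_def cl_mult_def sum_distrib_left
  proof (intro sum.cong refl)
    fix A B assume "A \<in> Pow {1..p+q+r}" "B \<in> Pow {1..p+q+r}"
    then have "finite A" "finite B" by (auto intro: finite_subset)
    from card_sym_diff_add[OF this]
    have "(-1::'a) ^ card (sym_diff A B) = (-1) ^ card A * (-1) ^ card B"
      unfolding power_add[symmetric] by (intro minus_one_power_cong) presburger
    then show "(-1) ^ card C * (if sym_diff A B = C then cl_coeff p q A B * x A * y B else 0) =
      (if sym_diff A B = C then cl_coeff p q A B * ((-1) ^ card A * x A) * ((-1) ^ card B * y B) else 0)"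
      by (auto simp: mult_ac)
  qed
qed

lemma cl_conj_conj: "cl_conj (cl_conj x) = x"
  by (simp add: fun_eq_iff cl_conj_apply cl_conj_sign_def mult.assoc[symmetric] power_add[symmetric])

lemma cl_hat_hat: "cl_hat (cl_hat x) = x"
  by (simp add: fun_eq_iff cl_hat_def mult.assoc[symmetric] power_add[symmetric])

lemma cl_hat_conj: "cl_hat (cl_conj x) = cl_conj (cl_hat x)"
  by (simp add: fun_eq_iff cl_conj_apply cl_hat_def mult_ac)

lemma cl_conj_add: "cl_conj (\<lambda>A. x A + y A) = (\<lambda>A. cl_conj x A + cl_conj y A)"
  by (simp add: fun_eq_iff cl_conj_apply algebra_simps)

lemma cl_hat_add: "cl_hat (\<lambda>A. x A + y A) = (\<lambda>A. cl_hat x A + cl_hat y A)"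
  by (simp add: fun_eq_iff cl_hat_def algebra_simps)

lemma cl_conj_smult: "cl_conj (cl_smult c x) = cl_smult c (cl_conj x)"
  by (simp add: fun_eq_iff cl_conj_apply cl_smult_def mult_ac)

lemma cl_hat_smult: "cl_hat (cl_smult c x) = cl_smult c (cl_hat x)"
  by (simp add: fun_eq_iff cl_hat_def cl_smult_def mult_ac)

lemma cl_conj_one: "cl_conj (cl_basis {}) = cl_basis {}"
  by (simp add: fun_eq_iff cl_conj_apply cl_conj_sign_def cl_basis_def)

lemma cl_hat_one: "cl_hat (cl_basis {}) = cl_basis {}"
  by (simp add: fun_eq_iff cl_hat_def cl_basis_def)

lemma cl_carrier_closed:
  "cl_conj x \<in> carrier (Cl p q r) \<longleftrightarrow> x \<in> carrier (Cl p q r)"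
  "x \<in> carrier (Cl p q r) \<Longrightarrow> cl_smult c x \<in> carrier (Cl p q r)"
  "cl_basis {} \<in> carrier (Cl p q r)"
  by (auto simp: Cl_simps cl_conj_apply cl_conj_sign_def cl_smult_def cl_basis_def)

lemma cl_carrier_add:
  assumes "x \<in> carrier (Cl p q r)" "y \<in> carrier (Cl p q r)"
  shows "(\<lambda>A. x A + y A) \<in> carrier (Cl p q r)"
  using assms unfolding Cl_simps by (metis add_0)

lemma cl_UnitsI:
  assumes "x \<in> carrier (Cl p q r)" "y \<in> carrier (Cl p q r)" "z \<in> carrier (Cl p q r)"
    and "cl_mult p q r y x = cl_basis {}" "cl_mult p q r x z = cl_basis {}"
  shows "x \<in> Units (Cl p q r)"
proof -
  have "y = cl_mult p q r y (cl_mult p q r x z)" using assms cl_mult_one(2) by metis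
  also have "\<dots> = z" using assms by (metis cl_mult_assoc cl_mult_one(1))
  finally show ?thesis using assms unfolding Units_def by (auto simp: Cl_simps(2,3))
qed

lemma cl_Units_conj:
  assumes "T \<in> Units (Cl p q r)"
  shows "cl_conj T \<in> Units (Cl p q r)"
proof -
  from assms obtain S where S: "T \<in> carrier (Cl p q r)" "S \<in> carrier (Cl p q r)"
      "cl_mult p q r S T = cl_basis {}" "cl_mult p q r T S = cl_basis {}"
    by (auto simp: Units_def Cl_simps(2,3))
  then show ?thesis
    by (intro cl_UnitsI[of _ p q r "cl_conj S" "cl_conj S"])
       (simp_all add: cl_carrier_closed cl_conj_mult[symmetric] cl_conj_one)
qed

lemma cl_Units_mult:
  assumes "S \<in> Units (Cl p q r)" "T \<in> Units (Cl p q r)"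
  shows "cl_mult p q r S T \<in> Units (Cl p q r)"
  using monoid.Units_m_closed[OF ring.is_monoid[OF ring_Cl] assms] by (simp add: Cl_simps)

section \<open>The nilpotent ideal generated by the null generators\<close>

text \<open>
  The \<open>k\<close>-th power \<open>J\<^sup>k\<close> of the two-sided ideal \<open>J\<close> generated by the null generators, described by the basis
  elements that it contains; \<open>J\<^sup>0\<close> is the whole algebra.
\<close>

definition cl_null_power :: "nat \<Rightarrow> nat \<Rightarrow> nat \<Rightarrow> nat \<Rightarrow> 'a::field multivector set" where
  "cl_null_power p q r k =
     {x \<in> carrier (Cl p q r). \<forall>A. x A \<noteq> 0 \<longrightarrow> k \<le> card (A \<inter> {p+q+1..p+q+r})}"

text \<open>
  A null generator that two factors share makes their product vanish, and one that they do not share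
  survives in it. So the number of null generators is additive on nonzero products of basis elements.
\<close>

lemma cl_null_power_mult:
  fixes x y :: "'a::field multivector"
  assumes "x \<in> cl_null_power p q r k" "y \<in> cl_null_power p q r l"
  shows "cl_mult p q r x y \<in> cl_null_power p q r (k + l)"
proof -
  let ?Q = "{p+q+1..p+q+r}"
  have "k + l \<le> card (C \<inter> ?Q)" if "cl_mult p q r x y C \<noteq> 0" for C
  proof -
    from that obtain A B where AB: "A \<subseteq> {1..p+q+r}" "B \<subseteq> {1..p+q+r}" "C = sym_diff A B"
      "x A \<noteq> 0" "y B \<noteq> 0" "(cl_coeff p q A B :: 'a) \<noteq> 0" by (rule cl_mult_nonzeroE)
    have disj: "A \<inter> B \<inter> ?Q = {}"
      using AB(6) cl_coeff_eq_0_iff[OF AB(1)] by blast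
    then have "C \<inter> ?Q = (A \<inter> ?Q) \<union> (B \<inter> ?Q)" using AB(3) by blast
    moreover have "card ((A \<inter> ?Q) \<union> (B \<inter> ?Q)) = card (A \<inter> ?Q) + card (B \<inter> ?Q)"
      by (rule card_Un_disjoint) (use disj in auto)
    moreover have "k \<le> card (A \<inter> ?Q)" "l \<le> card (B \<inter> ?Q)"
      using assms AB by (auto simp: cl_null_power_def)
    ultimately show ?thesis by (metis add_mono)
  qed
  then show ?thesis
    using assms cl_mult_closed unfolding cl_null_power_def by blast
qed

lemma cl_null_power_eq_0:
  assumes "x \<in> cl_null_power p q r k" "r < k"
  shows "x = (\<lambda>A. 0)"
proof
  fix A
  have "card (A \<inter> {p+q+1..p+q+r}) \<le> card {p+q+1..p+q+r}" by (rule card_mono) auto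
  then have "card (A \<inter> {p+q+1..p+q+r}) \<le> r" by simp
  then show "x A = 0" using assms by (fastforce simp: cl_null_power_def)
qed

lemma cl_null_power_smult:
  "x \<in> cl_null_power p q r k \<Longrightarrow> cl_smult c x \<in> cl_null_power p q r k"
  by (auto simp: cl_null_power_def cl_carrier_closed) (auto simp: cl_smult_def)

lemma cl_null_power_0: "cl_null_power p q r 0 = carrier (Cl p q r)"
  by (auto simp: cl_null_power_def)

section \<open>Subalgebras stable under Clifford conjugation\<close>

definition cl_conj_subalgebra :: "nat \<Rightarrow> nat \<Rightarrow> nat \<Rightarrow> 'a::field multivector set \<Rightarrow> bool" where
  "cl_conj_subalgebra p q r H \<longleftrightarrow> H \<subseteq> carrier (Cl p q r) \<and> cl_basis {} \<in> H \<and>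
     (\<forall>c. \<forall>x\<in>H. cl_smult c x \<in> H) \<and> (\<forall>x\<in>H. \<forall>y\<in>H. (\<lambda>A. x A + y A) \<in> H) \<and>
     (\<forall>x\<in>H. \<forall>y\<in>H. cl_mult p q r x y \<in> H) \<and> (\<forall>x\<in>H. cl_conj x \<in> H)"

lemma cl_conj_subalgebraD:
  assumes "cl_conj_subalgebra p q r H"
  shows "x \<in> H \<Longrightarrow> x \<in> carrier (Cl p q r)" "cl_basis {} \<in> H" "x \<in> H \<Longrightarrow> cl_smult c x \<in> H"
    "x \<in> H \<Longrightarrow> y \<in> H \<Longrightarrow> (\<lambda>A. x A + y A) \<in> H"
    "x \<in> H \<Longrightarrow> y \<in> H \<Longrightarrow> cl_mult p q r x y \<in> H" "x \<in> H \<Longrightarrow> cl_conj x \<in> H"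
  using assms unfolding cl_conj_subalgebra_def by blast+

lemma cl_conj_subalgebra_Int:
  "cl_conj_subalgebra p q r H \<Longrightarrow> cl_conj_subalgebra p q r K \<Longrightarrow> cl_conj_subalgebra p q r (H \<inter> K)"
  unfolding cl_conj_subalgebra_def by blast

text \<open>
  Instead of summing the geometric series, use \<open>(1 + x)(1 - x) = 1 - x\<^sup>2\<close>: this moves \<open>x \<in> J\<^sup>k\<close> to
  \<open>x\<^sup>2 \<in> J^(2k)\<close>, and after finitely many steps nothing but 1 is left. All elements involved stay in \<open>H\<close>.
\<close>

lemma cl_one_plus_null_inverse:
  assumes H: "cl_conj_subalgebra p q r H"
    and "x \<in> H" "x \<in> cl_null_power p q r k" "0 < k"
  shows "\<exists>y\<in>H. cl_mult p q r (\<lambda>A. cl_basis {} A + x A) y = cl_basis {} \<and>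
               cl_mult p q r y (\<lambda>A. cl_basis {} A + x A) = cl_basis {}"
  using assms(2-4)
proof (induction "Suc r - k" arbitrary: x k rule: less_induct)
  case less
  note D = cl_conj_subalgebraD[OF H]
  let ?one = "cl_basis {} :: 'a multivector"
  let ?z = "cl_smult (-1) (cl_mult p q r x x)"
  let ?a = "\<lambda>A. ?one A + x A" and ?b = "\<lambda>A. ?one A + cl_smult (-1) x A"
  note one = cl_mult_one[OF cl_carrier_closed(3)] cl_mult_one[OF D(1)[OF less.prems(1)]]
  have ab: "cl_mult p q r ?a ?b = (\<lambda>A. ?one A + ?z A)" "cl_mult p q r ?b ?a = (\<lambda>A. ?one A + ?z A)"
    by (simp_all only: cl_mult_add cl_mult_smult one) (simp_all add: cl_smult_def)
  have aH: "?a \<in> H" and bH: "?b \<in> H" by (intro D less.prems)+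
  show ?case
  proof (cases "r < k")
    case True
    then have "x = (\<lambda>A. 0)" using less.prems cl_null_power_eq_0 by blast
    then show ?thesis using D(2) by (intro bexI[of _ ?one]) (simp_all add: one)
  next
    case False
    have "?z \<in> H" by (intro D less.prems)
    moreover have "?z \<in> cl_null_power p q r (k + k)"
      by (intro cl_null_power_smult cl_null_power_mult less.prems)
    moreover have "Suc r - (k + k) < Suc r - k" using less.prems(3) False by linarith
    ultimately obtain y where y: "y \<in> H" "cl_mult p q r (\<lambda>A. ?one A + ?z A) y = ?one"
        "cl_mult p q r y (\<lambda>A. ?one A + ?z A) = ?one"
      using less.hyps[of "k + k" ?z] less.prems(3) by blast
    let ?l = "cl_mult p q r y ?b" and ?r = "cl_mult p q r ?b y"
    have l: "cl_mult p q r ?l ?a = ?one" and r: "cl_mult p q r ?a ?r = ?one"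
      using y ab by (metis cl_mult_assoc)+
    have lH: "?l \<in> H" and rH: "?r \<in> H" by (intro D y bH)+
    have "?l = cl_mult p q r ?l (cl_mult p q r ?a ?r)" using r cl_mult_one(2)[OF D(1)[OF lH]] by simp
    also have "\<dots> = ?r" using l cl_mult_one(1)[OF D(1)[OF rH]] by (simp only: cl_mult_assoc[symmetric])
    finally show ?thesis using l r rH by metis
  qed
qed

text \<open>
  A conjugation-symmetric element \<open>c + x\<close> with \<open>x \<in> J\<close> can be brought to the form \<open>c\<close> by a congruence within
  \<open>H\<close>; the transforming \<open>h\<close> plays the role of \<open>(1 + x/c)^(-1/2)\<close>. It is built by a Newton-like iteration: the
  first-order approximation \<open>1 - x/(2c)\<close> replaces \<open>x \<in> J\<^sup>k\<close> by
  \<open>x\<^sup>2 (x/(4c\<^sup>2) - 3/(4c)) \<in> J^(2k)\<close>, again symmetric and in \<open>H\<close>. As \<open>J\<close> is nilpotent, the iteration stops.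
\<close>

lemma cl_scalar_plus_null_congruent_scalar:
  fixes H :: "'a::field_char_0 multivector set"
  assumes H: "cl_conj_subalgebra p q r H" and c: "c \<noteq> 0"
    and "x \<in> H" "cl_conj x = x" "x \<in> cl_null_power p q r k" "0 < k"
  shows "\<exists>h\<in>H. \<exists>h'\<in>H. cl_mult p q r h h' = cl_basis {} \<and> cl_mult p q r h' h = cl_basis {} \<and>
    cl_mult p q r (cl_conj h) (cl_mult p q r (\<lambda>A. cl_smult c (cl_basis {}) A + x A) h) = cl_smult c (cl_basis {})"
  using assms(3-)
proof (induction "Suc r - k" arbitrary: x k rule: less_induct)
  case less
  note D = cl_conj_subalgebraD[OF H]
  let ?one = "cl_basis {} :: 'a multivector"
  note one = cl_mult_one[OF cl_carrier_closed(3)] cl_mult_one[OF D(1)[OF less.prems(1)]]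
    cl_mult_one[OF cl_mult_closed[OF D(1)[OF less.prems(1)] D(1)[OF less.prems(1)]]]
  show ?case
  proof (cases "r < k")
    case True
    then have "x = (\<lambda>A. 0)" using less.prems cl_null_power_eq_0 by blast
    then show ?thesis using D(2)
      by (intro bexI[of _ ?one]) (simp_all add: cl_conj_one cl_mult_smult one)
  next
    case False
    let ?d = "- 1 / (2 * c)"
    let ?h = "\<lambda>A. ?one A + cl_smult ?d x A"
    let ?N = "\<lambda>A. cl_smult c ?one A + x A"
    let ?w = "\<lambda>A. cl_smult (- 3 / (4 * c)) ?one A + cl_smult (1 / (4 * c ^ 2)) x A"
    let ?z = "cl_mult p q r (cl_mult p q r x x) ?w"
    have hconj: "cl_conj ?h = ?h"
      by (simp add: cl_conj_add cl_conj_one cl_conj_smult less.prems)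
    have xH: "cl_smult ?d x \<in> H" and hH: "?h \<in> H" and zH: "?z \<in> H" by (intro D less.prems)+
    have zx: "?z \<in> cl_null_power p q r (k + k + 0)"
      by (intro cl_null_power_mult less.prems) (unfold cl_null_power_0, intro D less.prems)
    obtain h1 where h1: "h1 \<in> H" "cl_mult p q r ?h h1 = ?one" "cl_mult p q r h1 ?h = ?one"
      using cl_one_plus_null_inverse[OF H xH cl_null_power_smult] less.prems by blast
    \<comment> \<open>Everything here is a polynomial in \<open>x\<close>, so the identity is \<open>(1-y)(1+2y)(1-y) = 1 - 3y\<^sup>2 + 2y\<^sup>3\<close> with \<open>y = x/(2c)\<close>.\<close>
    have hNh: "cl_mult p q r (cl_conj ?h) (cl_mult p q r ?N ?h) = (\<lambda>A. cl_smult c ?one A + ?z A)"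
      unfolding hconj
      by (simp only: cl_mult_add cl_mult_smult one cl_mult_assoc)
         (use c in \<open>simp add: cl_smult_def fun_eq_iff field_simps power2_eq_square\<close>)
    \<comment> \<open>Conjugation reverses the order of the factors, but they commute with each other.\<close>
    have "cl_conj ?z = ?z"
    proof -
      have "cl_conj ?z = cl_mult p q r ?w (cl_mult p q r x x)"
        by (simp add: cl_conj_mult cl_conj_add cl_conj_one cl_conj_smult less.prems)
      also have "\<dots> = ?z"
        by (simp only: cl_mult_add cl_mult_smult one cl_mult_assoc)
      finally show ?thesis .
    qed
    moreover have "Suc r - (k + k + 0) < Suc r - k" using less.prems(4) False by linarith
    ultimately obtain g g' where g: "g \<in> H" "g' \<in> H" "cl_mult p q r g g' = ?one" "cl_mult p q r g' g = ?one"
      and gz: "cl_mult p q r (cl_conj g) (cl_mult p q r (\<lambda>A. cl_smult c ?one A + ?z A) g) = cl_smult c ?one"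
      using less.hyps[of "k + k + 0" ?z] zH zx less.prems(4) by blast
    let ?f = "cl_mult p q r ?h g" and ?f' = "cl_mult p q r g' h1"
    have "cl_mult p q r ?f ?f' = cl_mult p q r ?h (cl_mult p q r (cl_mult p q r g g') h1)"
      by (simp only: cl_mult_assoc)
    then have 1: "cl_mult p q r ?f ?f' = ?one"
      by (simp only: g h1 cl_mult_one[OF D(1)[OF h1(1)]])
    have "cl_mult p q r ?f' ?f = cl_mult p q r g' (cl_mult p q r (cl_mult p q r h1 ?h) g)"
      by (simp only: cl_mult_assoc)
    then have 2: "cl_mult p q r ?f' ?f = ?one"
      by (simp only: g h1 cl_mult_one[OF D(1)[OF g(1)]])
    have "cl_mult p q r (cl_conj ?f) (cl_mult p q r ?N ?f) =
       cl_mult p q r (cl_conj g) (cl_mult p q r (cl_mult p q r (cl_conj ?h) (cl_mult p q r ?N ?h)) g)"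
      by (simp only: cl_conj_mult cl_mult_assoc)
    then have 3: "cl_mult p q r (cl_conj ?f) (cl_mult p q r ?N ?f) = cl_smult c ?one"
      by (simp only: hNh gz)
    have "?f \<in> H" "?f' \<in> H" by (intro D g h1 hH)+
    with 1 2 3 show ?thesis by blast
  qed
qed

lemma cl_null_power_not_unit:
  fixes x :: "'a::field multivector"
  assumes "x \<in> cl_null_power p q r k" "0 < k"
  shows "x \<notin> Units (Cl p q r)"
proof
  assume "x \<in> Units (Cl p q r)"
  then obtain y where y: "y \<in> carrier (Cl p q r)" "cl_mult p q r x y = cl_basis {}"
    by (auto simp: Units_def Cl_simps(2,3))
  then have "(cl_basis {} :: 'a multivector) \<in> cl_null_power p q r (k + 0)"
    using cl_null_power_mult[OF assms(1), of y 0] by (simp add: cl_null_power_0)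
  then show False using assms(2) by (auto simp: cl_null_power_def cl_basis_def dest: spec[of _ "{}"])
qed

section \<open>Even Grassmann elements are central\<close>

lemma cl_Lambda_even_carrier: "cl_Lambda_even p q r \<subseteq> carrier (Cl p q r)"
  by (auto simp: cl_Lambda_even_def cl_even_def)

text \<open>
  A basis element of even grade commutes with every \<open>e\<^sub>B\<close> up to the sign \<open>(-1)^|A \<inter> B|\<close>. As \<open>A\<close> consists of null
  indices, both products are zero as soon as \<open>A\<close> meets \<open>B\<close>, and otherwise the sign is \<open>+1\<close>.
\<close>

lemma cl_Lambda_even_commute:
  fixes x y :: "'a::field multivector"
  assumes "x \<in> cl_Lambda_even p q r"
  shows "cl_mult p q r x y = cl_mult p q r y x"
proof (rule cl_mult_commuteI)
  fix A B assume AB: "A \<subseteq> {1..p+q+r}" "B \<subseteq> {1..p+q+r}" "x A \<noteq> 0"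
  then have fin: "finite A" "finite B" by (auto intro: finite_subset)
  from AB(3) assms have A: "A \<subseteq> {p+q+1..p+q+r}" "even (card A)"
    by (auto simp: cl_Lambda_even_def cl_Lambda_eq cl_even_def)
  show "cl_coeff p q A B = (cl_coeff p q B A :: 'a)"
  proof (cases "A \<inter> B = {}")
    case True
    then show ?thesis using A by (simp add: cl_coeff_swap[OF fin])
  next
    case False
    then have "(cl_coeff p q A B :: 'a) = 0"
      using A cl_coeff_eq_0_iff[OF AB(1), of B] by blast
    then show ?thesis by (simp add: cl_coeff_swap[OF fin])
  qed
qed

lemma cl_scalar_in_Lambda_even: "cl_smult c (cl_basis {}) \<in> cl_Lambda_even p q r"
  by (auto simp: cl_Lambda_even_def cl_Lambda_eq cl_even_def Cl_simps cl_smult_def cl_basis_def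
      split: if_splits)

section \<open>Factorization of groups defined by the norm\<close>

text \<open>
  The hypothesis on symmetric elements says that \<open>e\<^sub>A\<close> with nonempty \<open>A\<close> can occur in them only if it
  contains a null generator, that is, symmetric elements of \<open>H\<close> are scalars modulo \<open>J\<close>. This puts norms
  into the form required for the inverse square root above.
\<close>

lemma cl_norm_group_factorization:
  fixes H :: "'a::field_char_0 multivector set"
  assumes H: "cl_conj_subalgebra p q r H" and L: "cl_Lambda_even p q r \<subseteq> H"
    and sym: "\<And>x A. x \<in> H \<Longrightarrow> cl_conj x = x \<Longrightarrow> x A \<noteq> 0 \<Longrightarrow> A \<noteq> {} \<Longrightarrow> A \<inter> {p+q+1..p+q+r} \<noteq> {}"
  shows "{T \<in> Units (Cl p q r). cl_conj T \<otimes>\<^bsub>Cl p q r\<^esub> T \<in> cl_invertible p q r H} =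
         cl_twisted_B p q r <#>\<^bsub>Cl p q r\<^esub> cl_invertible p q r H" (is "?B = ?P")
proof (intro equalityI subsetI)
  note D = cl_conj_subalgebraD[OF H]
  let ?one = "cl_basis {} :: 'a multivector"
  fix T assume "T \<in> ?B"
  then have T: "T \<in> Units (Cl p q r)" and NH: "cl_mult p q r (cl_conj T) T \<in> H"
    and NU: "cl_mult p q r (cl_conj T) T \<in> Units (Cl p q r)"
    by (auto simp: cl_invertible_def Cl_simps)
  from T have Tc: "T \<in> carrier (Cl p q r)" by (simp add: Units_def)
  define N where "N = cl_mult p q r (cl_conj T) T"
  have Nsym: "cl_conj N = N" by (simp add: N_def cl_conj_mult cl_conj_conj)
  define c where "c = N {}"
  define x where "x = (\<lambda>A. N A + cl_smult (- c) ?one A)"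
  have xH: "x \<in> H" unfolding x_def N_def by (intro D NH)
  have xsym: "cl_conj x = x" unfolding x_def by (simp only: cl_conj_add cl_conj_smult cl_conj_one Nsym)
  have xJ: "x \<in> cl_null_power p q r 1"
  proof -
    have "1 \<le> card (A \<inter> {p+q+1..p+q+r})" if "x A \<noteq> 0" for A
    proof -
      have "A \<noteq> {}" using that by (auto simp: x_def c_def cl_smult_def cl_basis_def)
      then have "A \<inter> {p+q+1..p+q+r} \<noteq> {}" using sym[OF xH xsym that] by blast
      then show ?thesis by (simp add: Suc_le_eq card_gt_0_iff)
    qed
    then show ?thesis using D(1)[OF xH] by (auto simp: cl_null_power_def)
  qed
  have Nx: "N = (\<lambda>A. cl_smult c ?one A + x A)" by (simp add: x_def cl_smult_def)
  \<comment> \<open>The norm is invertible, and elements of \<open>J\<close> are not.\<close>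
  have "c \<noteq> 0"
  proof
    assume "c = 0"
    then have "N = x" by (simp add: Nx cl_smult_def)
    then show False using NU cl_null_power_not_unit[OF xJ] by (simp add: N_def)
  qed
  then obtain h h' where h: "h \<in> H" "h' \<in> H" "cl_mult p q r h h' = ?one" "cl_mult p q r h' h = ?one"
    and hN: "cl_mult p q r (cl_conj h) (cl_mult p q r N h) = cl_smult c ?one"
    using cl_scalar_plus_null_congruent_scalar[OF H _ xH xsym xJ, of c] unfolding Nx by auto
  have hU: "h \<in> Units (Cl p q r)" "h' \<in> Units (Cl p q r)" using h D(1) cl_UnitsI by blast+
  let ?g = "cl_mult p q r T h"
  have gU: "?g \<in> Units (Cl p q r)" by (rule cl_Units_mult[OF T hU(1)])
  have "cl_mult p q r (cl_conj ?g) ?g = cl_smult c ?one"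
    unfolding hN[symmetric] N_def by (simp only: cl_conj_mult cl_mult_assoc)
  moreover have "cl_mult p q r (cl_conj ?g) ?g \<in> Units (Cl p q r)"
    by (intro cl_Units_mult cl_Units_conj gU)
  ultimately have "?g \<in> cl_twisted_B p q r"
    using gU cl_scalar_in_Lambda_even by (auto simp: cl_twisted_B_def cl_invertible_def Cl_simps(2))
  moreover have "T = cl_mult p q r ?g h'"
    by (simp add: cl_mult_assoc h cl_mult_one Tc)
  moreover have "h' \<in> cl_invertible p q r H" using h hU by (simp add: cl_invertible_def)
  ultimately show "T \<in> ?P" unfolding set_mult_def Cl_simps(2) by blast
next
  note D = cl_conj_subalgebraD[OF H]
  fix T assume "T \<in> ?P"
  then obtain g h where T: "T = cl_mult p q r g h" and g: "g \<in> Units (Cl p q r)"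
    and gL: "cl_mult p q r (cl_conj g) g \<in> cl_Lambda_even p q r"
    and h: "h \<in> H" "h \<in> Units (Cl p q r)"
    by (auto simp: set_mult_def cl_twisted_B_def cl_invertible_def Cl_simps(2))
  have TU: "T \<in> Units (Cl p q r)" unfolding T by (intro cl_Units_mult g h)
  have "cl_mult p q r (cl_conj T) T = cl_mult p q r (cl_conj h) (cl_mult p q r (cl_mult p q r (cl_conj g) g) h)"
    unfolding T by (simp only: cl_conj_mult cl_mult_assoc)
  also have "\<dots> \<in> H" using gL L by (intro D(5)[OF D(6)[OF h(1)] D(5)[OF _ h(1)]]) blast
  finally have "cl_mult p q r (cl_conj T) T \<in> H" .
  moreover have "cl_mult p q r (cl_conj T) T \<in> Units (Cl p q r)"
    by (intro cl_Units_mult cl_Units_conj TU)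
  ultimately show "T \<in> ?B" using TU by (simp add: cl_invertible_def Cl_simps(2))
qed

section \<open>Centralizers\<close>

lemma cl_conj_grade:
  assumes "V \<in> cl_grade p q r m"
  shows "cl_conj V = cl_smult ((-1) ^ (m * (m + 1) div 2)) V"
  using assms by (force simp: fun_eq_iff cl_conj_apply cl_smult_def cl_conj_sign_def cl_grade_def)

lemma cl_hat_grade:
  assumes "V \<in> cl_grade p q r m"
  shows "cl_hat V = cl_smult ((-1) ^ m) V"
  using assms by (force simp: fun_eq_iff cl_hat_def cl_smult_def cl_grade_def)

lemma cl_smult_cancel: "c \<noteq> 0 \<Longrightarrow> cl_smult c x = cl_smult c y \<longleftrightarrow> x = y"
  by (auto simp: fun_eq_iff cl_smult_def)

text \<open>
  Conjugation reverses the equation \<open>x V = V x\<close> and multiplies \<open>V\<close>, which is homogeneous, by a sign that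
  cancels. This is why centralizers of grade subspaces are stable under it.
\<close>

lemma cl_Z_conj_subalgebra: "cl_conj_subalgebra p q r (cl_Z p q r m)"
  unfolding cl_conj_subalgebra_def
proof (intro conjI allI ballI)
  fix x y :: "'a multivector" and c assume x: "x \<in> cl_Z p q r m"
  show "cl_smult c x \<in> cl_Z p q r m"
    using x by (simp add: cl_Z_def Cl_simps(2) cl_carrier_closed cl_mult_smult)
  show "cl_conj x \<in> cl_Z p q r m"
  proof -
    have "cl_mult p q r (cl_conj x) V = cl_mult p q r V (cl_conj x)" if V: "V \<in> cl_grade p q r m" for V
    proof -
      have "cl_mult p q r x V = cl_mult p q r V x" using x V by (simp add: cl_Z_def Cl_simps(2))
      then have "cl_conj (cl_mult p q r V x) = cl_conj (cl_mult p q r x V)" by simp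
      then show ?thesis
        unfolding cl_conj_mult cl_conj_grade[OF V] cl_mult_smult by (simp add: cl_smult_cancel)
    qed
    then show ?thesis using x by (simp add: cl_Z_def Cl_simps(2) cl_carrier_closed)
  qed
  assume y: "y \<in> cl_Z p q r m"
  show "(\<lambda>A. x A + y A) \<in> cl_Z p q r m"
    using x y by (simp add: cl_Z_def Cl_simps(2) cl_carrier_add cl_mult_add)
  have "cl_mult p q r (cl_mult p q r x y) V = cl_mult p q r V (cl_mult p q r x y)"
    if "V \<in> cl_grade p q r m" for V
  proof -
    have "cl_mult p q r x V = cl_mult p q r V x" "cl_mult p q r y V = cl_mult p q r V y"
      using x y that by (simp_all add: cl_Z_def Cl_simps(2))
    then show ?thesis by (metis cl_mult_assoc)
  qed
  then show "cl_mult p q r x y \<in> cl_Z p q r m"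
    using x y by (simp add: cl_Z_def Cl_simps(2) cl_mult_closed)
qed (auto simp: cl_Z_def cl_grade_def Cl_simps(2) cl_carrier_closed cl_mult_one)

text \<open>
  Conjugating \<open>x^ V = V x\<close>, where \<open>x^\<close> is the grade involute, puts the involution on the wrong side of the
  equation; applying the grade involution once more repairs this, again up to signs that cancel.
\<close>

lemma cl_twisted_Z_conj_subalgebra: "cl_conj_subalgebra p q r (cl_twisted_Z p q r m)"
  unfolding cl_conj_subalgebra_def
proof (intro conjI allI ballI)
  fix x y :: "'a multivector" and c assume x: "x \<in> cl_twisted_Z p q r m"
  show "cl_smult c x \<in> cl_twisted_Z p q r m"
    using x by (simp add: cl_twisted_Z_def Cl_simps(2) cl_carrier_closed cl_mult_smult cl_hat_smult)
  show "cl_conj x \<in> cl_twisted_Z p q r m"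
  proof -
    have "cl_mult p q r (cl_hat (cl_conj x)) V = cl_mult p q r V (cl_conj x)"
      if V: "V \<in> cl_grade p q r m" for V
    proof -
      have "cl_mult p q r (cl_hat x) V = cl_mult p q r V x"
        using x V by (simp add: cl_twisted_Z_def Cl_simps(2))
      then have "cl_hat (cl_conj (cl_mult p q r V x)) = cl_hat (cl_conj (cl_mult p q r (cl_hat x) V))"
        by simp
      then show ?thesis
        unfolding cl_conj_mult cl_hat_mult cl_hat_conj cl_hat_hat cl_conj_grade[OF V] cl_mult_smult
          cl_hat_smult cl_hat_grade[OF V]
        by (simp add: cl_smult_cancel cl_hat_conj cl_conj_smult cl_conj_grade[OF V] cl_mult_smult)
    qed
    then show ?thesis using x by (simp add: cl_twisted_Z_def Cl_simps(2) cl_carrier_closed)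
  qed
  assume y: "y \<in> cl_twisted_Z p q r m"
  show "(\<lambda>A. x A + y A) \<in> cl_twisted_Z p q r m"
    using x y by (simp add: cl_twisted_Z_def Cl_simps(2) cl_carrier_add cl_mult_add cl_hat_add)
  have "cl_mult p q r (cl_hat (cl_mult p q r x y)) V = cl_mult p q r V (cl_mult p q r x y)"
    if "V \<in> cl_grade p q r m" for V
  proof -
    have "cl_mult p q r (cl_hat x) V = cl_mult p q r V x" "cl_mult p q r (cl_hat y) V = cl_mult p q r V y"
      using x y that by (simp_all add: cl_twisted_Z_def Cl_simps(2))
    then show ?thesis by (metis cl_mult_assoc cl_hat_mult)
  qed
  then show "cl_mult p q r x y \<in> cl_twisted_Z p q r m"
    using x y by (simp add: cl_twisted_Z_def Cl_simps(2) cl_mult_closed)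
qed (auto simp: cl_twisted_Z_def cl_grade_def Cl_simps(2) cl_carrier_closed cl_mult_one cl_hat_one)

lemma cl_Lambda_even_subset_Z: "cl_Lambda_even p q r \<subseteq> cl_Z p q r m"
  using cl_Lambda_even_carrier cl_Lambda_even_commute
  by (fastforce simp: cl_Z_def Cl_simps(2))

lemma cl_hat_even: "x \<in> cl_even p q r \<Longrightarrow> cl_hat x = x"
  by (force simp: cl_even_def cl_hat_def fun_eq_iff)

lemma cl_Lambda_even_subset_twisted_Z: "cl_Lambda_even p q r \<subseteq> cl_twisted_Z p q r m"
proof
  fix x :: "'a multivector" assume x: "x \<in> cl_Lambda_even p q r"
  then have "cl_hat x = x" using cl_hat_even[of x p q r] by (simp add: cl_Lambda_even_def)
  then show "x \<in> cl_twisted_Z p q r m"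
    using x cl_Lambda_even_carrier cl_Lambda_even_commute[OF x]
    by (fastforce simp: cl_twisted_Z_def Cl_simps(2))
qed

lemma cl_basis_in_grade: "B \<subseteq> {1..p+q+r} \<Longrightarrow> cl_basis B \<in> cl_grade p q r (card B)"
  by (auto simp: cl_grade_def Cl_simps cl_basis_def split: if_splits)

lemma cl_Z_coeff:
  fixes x :: "'a::field multivector"
  assumes "x \<in> cl_Z p q r m" "x A \<noteq> 0" "B \<subseteq> {1..p+q+r}" "card B = m"
  shows "cl_coeff p q A B = (cl_coeff p q B A :: 'a::field)"
proof -
  have A: "A \<subseteq> {1..p+q+r}" using assms(1,2) by (auto simp: cl_Z_def Cl_simps(1))
  have "cl_mult p q r x (cl_basis B) = cl_mult p q r (cl_basis B) x"
    using assms(1) cl_basis_in_grade[OF assms(3)] assms(4) by (auto simp: cl_Z_def Cl_simps(2))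
  then show ?thesis using cl_mult_basis_at[OF A assms(3), of x] assms(2) by simp
qed

lemma cl_twisted_Z_coeff:
  fixes x :: "'a::field multivector"
  assumes "x \<in> cl_twisted_Z p q r m" "x A \<noteq> 0" "B \<subseteq> {1..p+q+r}" "card B = m"
  shows "(-1) ^ card A * cl_coeff p q A B = (cl_coeff p q B A :: 'a::field)"
proof -
  have A: "A \<subseteq> {1..p+q+r}" using assms(1,2) by (auto simp: cl_twisted_Z_def Cl_simps(1))
  have "cl_mult p q r (cl_hat x) (cl_basis B) = cl_mult p q r (cl_basis B) x"
    using assms(1) cl_basis_in_grade[OF assms(3)] assms(4) by (auto simp: cl_twisted_Z_def Cl_simps(2))
  then have "cl_coeff p q A B * cl_hat x A = cl_coeff p q B A * x A"
    using cl_mult_basis_at[OF A assms(3)] by metis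
  then show ?thesis using assms(2) by (simp add: cl_hat_def mult_ac)
qed

lemma cl_Z_parity:
  fixes x :: "'a::field_char_0 multivector"
  assumes "x \<in> cl_Z p q r m" "x A \<noteq> 0" "B \<subseteq> {1..p+q+r}" "card B = m" "A \<inter> B \<inter> {p+q+1..p+q+r} = {}"
  shows "even (card A * m + card (A \<inter> B))"
proof -
  have A: "A \<subseteq> {1..p+q+r}" using assms(1,2) by (auto simp: cl_Z_def Cl_simps(1))
  have fin: "finite A" "finite B" using A assms(3) finite_subset by blast+
  have nz: "(cl_coeff p q A B :: 'a) \<noteq> 0"
    using assms(5) cl_coeff_eq_0_iff[OF A, of B] by blast
  have "(-1::'a) ^ (card A * card B + card (A \<inter> B)) = 1"
    using cl_Z_coeff[OF assms(1-4)] nz unfolding cl_coeff_swap[OF fin] by simp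
  then show ?thesis using assms(4) by (auto simp: minus_one_power_iff split: if_splits)
qed

lemma cl_twisted_Z_parity:
  fixes x :: "'a::field_char_0 multivector"
  assumes "x \<in> cl_twisted_Z p q r m" "x A \<noteq> 0" "B \<subseteq> {1..p+q+r}" "card B = m" "A \<inter> B \<inter> {p+q+1..p+q+r} = {}"
  shows "even (card A + card A * m + card (A \<inter> B))"
proof -
  have A: "A \<subseteq> {1..p+q+r}" using assms(1,2) by (auto simp: cl_twisted_Z_def Cl_simps(1))
  have fin: "finite A" "finite B" using A assms(3) finite_subset by blast+
  have nz: "(cl_coeff p q A B :: 'a) \<noteq> 0"
    using assms(5) cl_coeff_eq_0_iff[OF A, of B] by blast
  have "(-1::'a) ^ card A = (-1) ^ (card A * card B + card (A \<inter> B))"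
    using cl_twisted_Z_coeff[OF assms(1-4)] nz unfolding cl_coeff_swap[OF fin] by simp
  then show ?thesis using assms(4) by (auto simp: minus_one_power_iff split: if_splits)
qed

text \<open>
  If \<open>e\<^sub>A\<close> commutes with all generators, then \<open>|A|\<close> is congruent modulo 2 to the indicator of \<open>i \<in> A\<close> for every
  \<open>i\<close> that does not annihilate \<open>e\<^sub>A\<close>. So \<open>A\<close> either avoids or contains all such indices of \<open>B\<close>, according to
  the parity of \<open>|A|\<close>. If \<open>e\<^sub>A e\<^sub>B \<noteq> 0\<close>, these are all indices of \<open>B\<close>, and in both cases the sign between \<open>e\<^sub>A e\<^sub>B\<close> and \<open>e\<^sub>B e\<^sub>A\<close> is \<open>+1\<close>.
\<close>

lemma cl_center_eq_Z1: "(cl_center p q r :: 'a::field_char_0 multivector set) = cl_Z p q r 1"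
proof (intro equalityI subsetI)
  fix x :: "'a multivector" assume "x \<in> cl_center p q r"
  then show "x \<in> cl_Z p q r 1" by (simp add: cl_center_def cl_Z_def cl_grade_def)
next
  fix x :: "'a multivector" assume x: "x \<in> cl_Z p q r 1"
  have "cl_mult p q r x V = cl_mult p q r V x" for V
  proof (rule cl_mult_commuteI)
    fix A B assume AB: "A \<subseteq> {1..p+q+r}" "B \<subseteq> {1..p+q+r}" "x A \<noteq> 0"
    then have fin: "finite A" "finite B" by (auto intro: finite_subset)
    show "cl_coeff p q A B = (cl_coeff p q B A :: 'a)"
    proof (cases "A \<inter> B \<inter> {p+q+1..p+q+r} = {}")
      case True
      have par: "even (card A + card (A \<inter> {i}))" if "i \<in> B" for i
      proof -
        have "even (card A * 1 + card (A \<inter> {i}))"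
          by (rule cl_Z_parity[OF x AB(3)]) (use that True AB(2) in auto)
        then show ?thesis by simp
      qed
      have "even (card A * card B + card (A \<inter> B))"
      proof (cases "even (card A)")
        case even: True
        have "i \<notin> A" if "i \<in> B" for i
        proof
          assume "i \<in> A"
          then have "A \<inter> {i} = {i}" by blast
          then show False using par[OF that] even by simp
        qed
        then have "A \<inter> B = {}" by blast
        then show ?thesis using even by simp
      next
        case False
        have "i \<in> A" if "i \<in> B" for i
        proof (rule ccontr)
          assume "i \<notin> A"
          then have "A \<inter> {i} = {}" by blast
          then show False using par[OF that] False by simp
        qed
        then have "A \<inter> B = B" by blast
        then show ?thesis using False by simp
      qed
      then show ?thesis by (simp add: cl_coeff_swap[OF fin])
    next
      case False
      then have "(cl_coeff p q A B :: 'a) = 0"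
        using cl_coeff_eq_0_iff[OF AB(1)] by blast
      then show ?thesis by (simp add: cl_coeff_swap[OF fin])
    qed
  qed
  then show "x \<in> cl_center p q r" using x by (simp add: cl_center_def cl_Z_def Cl_simps(2))
qed

text \<open>
  Conjugation is multiplication by \<open>-1\<close> on grades 1 and 2.
\<close>

lemma cl_conj_fixed_card_ge_3:
  fixes x :: "'a::field_char_0 multivector"
  assumes "cl_conj x = x" "x A \<noteq> 0" "finite A" "A \<noteq> {}"
  shows "3 \<le> card A"
proof (rule ccontr)
  assume "\<not> 3 \<le> card A"
  moreover have "card A \<noteq> 0" using assms by simp
  ultimately have "card A = 1 \<or> card A = 2" by linarith
  moreover have "cl_conj_sign A = (1 :: 'a)" using fun_cong[OF assms(1), of A] assms(2) by (simp add: cl_conj_apply)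
  ultimately show False by (auto simp: cl_conj_sign_def)
qed

text \<open>
  If \<open>A\<close> has no null index, compare two test products of three generators: one with all three indices
  in \<open>A\<close>, and one where one of these is exchanged for a null index outside \<open>A\<close>. Neither annihilates \<open>e\<^sub>A\<close>, but
  the two commutation signs are opposite. This is where degeneracy of the form enters: in the
  nondegenerate three-dimensional algebra \<open>e\<^sub>1e\<^sub>2e\<^sub>3\<close> is symmetric and central.
\<close>

lemma cl_Z3_symmetric_support:
  fixes x :: "'a::field_char_0 multivector"
  assumes x: "x \<in> cl_Z p q r 3" and sym: "cl_conj x = x" "x A \<noteq> 0" "A \<noteq> {}" and r: "r \<noteq> 0"
  shows "A \<inter> {p+q+1..p+q+r} \<noteq> {}"
proof
  assume Q: "A \<inter> {p+q+1..p+q+r} = {}"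
  have A: "A \<subseteq> {1..p+q+r}" using assms by (auto simp: cl_Z_def Cl_simps(1))
  then have "finite A" using finite_subset by blast
  then have "3 \<le> card A" using cl_conj_fixed_card_ge_3 sym by blast
  then obtain T where T: "T \<subseteq> A" "card T = 3" "finite T" by (rule obtain_subset_with_card_n)
  from T obtain a where a: "a \<in> T" by fastforce
  let ?z = "p + q + r"
  let ?S = "insert ?z (T - {a})"
  have z: "?z \<notin> A" using Q r by auto
  have "even (card A * 3 + card (A \<inter> T))"
    by (rule cl_Z_parity[OF x sym(2)]) (use T A Q in auto)
  moreover have "even (card A * 3 + card (A \<inter> ?S))"
    by (rule cl_Z_parity[OF x sym(2)]) (use T A Q z a r in \<open>auto simp: card_insert_if\<close>)
  moreover have "A \<inter> T = T" "A \<inter> ?S = T - {a}" using T z by auto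
  ultimately show False using T a by simp
qed

text \<open>
  Here the twist makes one test product suffice: if \<open>A\<close> has no null index and contains three indices
  forming \<open>T\<close>, then \<open>e\<^sub>A\<close> violates the twisted commutation with \<open>e\<^sub>T\<close>, whatever the parity of \<open>|A|\<close>.
\<close>

lemma cl_twisted_Z3_symmetric_support:
  fixes x :: "'a::field_char_0 multivector"
  assumes x: "x \<in> cl_twisted_Z p q r 3" and sym: "cl_conj x = x" "x A \<noteq> 0" "A \<noteq> {}"
  shows "A \<inter> {p+q+1..p+q+r} \<noteq> {}"
proof
  assume Q: "A \<inter> {p+q+1..p+q+r} = {}"
  have A: "A \<subseteq> {1..p+q+r}" using assms by (auto simp: cl_twisted_Z_def Cl_simps(1))
  then have "finite A" using finite_subset by blast
  then have "3 \<le> card A" using cl_conj_fixed_card_ge_3 sym by blast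
  then obtain T where T: "T \<subseteq> A" "card T = 3" "finite T" by (rule obtain_subset_with_card_n)
  have "even (card A + card A * 3 + card (A \<inter> T))"
    by (rule cl_twisted_Z_parity[OF x sym(2)]) (use T A Q in auto)
  moreover have "A \<inter> T = T" using T by auto
  ultimately show False using T by simp
qed

section \<open>The three factorizations\<close>

text \<open>
  The real and the complex statement differ only in the field and the signature.
\<close>

lemma cl_B_groups_factorization:
  assumes r: "r \<noteq> 0"
  shows "(cl_B12 p q r :: 'a::field_char_0 multivector set) =
           cl_twisted_B p q r <#>\<^bsub>Cl p q r\<^esub> cl_invertible p q r (cl_center p q r)"
    and "(cl_twisted_B23 p q r :: 'a multivector set) =
           cl_twisted_B p q r <#>\<^bsub>Cl p q r\<^esub>
             cl_invertible p q r (cl_twisted_Z p q r 2 \<inter> cl_twisted_Z p q r 3)"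
    and "(cl_B03 p q r :: 'a multivector set) =
           cl_twisted_B p q r <#>\<^bsub>Cl p q r\<^esub> cl_invertible p q r (cl_Z p q r 3)"
proof -
  have Z13: "(cl_Z p q r 1 :: 'a multivector set) \<subseteq> cl_Z p q r 3"
    unfolding cl_center_eq_Z1[symmetric] by (auto simp: cl_center_def cl_Z_def cl_grade_def)
  show "(cl_B12 p q r :: 'a multivector set) =
           cl_twisted_B p q r <#>\<^bsub>Cl p q r\<^esub> cl_invertible p q r (cl_center p q r)"
    unfolding cl_B12_def cl_center_eq_Z1
    by (rule cl_norm_group_factorization[OF cl_Z_conj_subalgebra cl_Lambda_even_subset_Z])
       (rule cl_Z3_symmetric_support[OF subsetD[OF Z13] _ _ _ r])
  show "(cl_twisted_B23 p q r :: 'a multivector set) =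
           cl_twisted_B p q r <#>\<^bsub>Cl p q r\<^esub>
             cl_invertible p q r (cl_twisted_Z p q r 2 \<inter> cl_twisted_Z p q r 3)"
    unfolding cl_twisted_B23_def
    by (rule cl_norm_group_factorization[OF cl_conj_subalgebra_Int[OF
          cl_twisted_Z_conj_subalgebra cl_twisted_Z_conj_subalgebra]
          Int_greatest[OF cl_Lambda_even_subset_twisted_Z cl_Lambda_even_subset_twisted_Z]])
       (rule cl_twisted_Z3_symmetric_support[OF IntD2])
  show "(cl_B03 p q r :: 'a multivector set) =
           cl_twisted_B p q r <#>\<^bsub>Cl p q r\<^esub> cl_invertible p q r (cl_Z p q r 3)"
    unfolding cl_B03_def
    by (rule cl_norm_group_factorization[OF cl_Z_conj_subalgebra cl_Lambda_even_subset_Z])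
       (rule cl_Z3_symmetric_support[OF _ _ _ _ r])
qed

theorem theorem5p9:
  fixes p q r n :: nat
  assumes "p + q + r = n" and "n \<ge> 1" and "r \<noteq> 0"
  shows
    "((cl_B12 p q r :: real multivector set) =
        cl_twisted_B p q r <#>\<^bsub>Cl p q r\<^esub> cl_invertible p q r (cl_center p q r) \<and>
      (cl_twisted_B23 p q r :: real multivector set) =
        cl_twisted_B p q r <#>\<^bsub>Cl p q r\<^esub>
          cl_invertible p q r (cl_twisted_Z p q r 2 \<inter> cl_twisted_Z p q r 3) \<and>
      (cl_B03 p q r :: real multivector set) =
        cl_twisted_B p q r <#>\<^bsub>Cl p q r\<^esub> cl_invertible p q r (cl_Z p q r 3)) \<and>
     ((cl_B12 (p+q) 0 r :: complex multivector set) =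
        cl_twisted_B (p+q) 0 r <#>\<^bsub>Cl (p+q) 0 r\<^esub> cl_invertible (p+q) 0 r (cl_center (p+q) 0 r) \<and>
      (cl_twisted_B23 (p+q) 0 r :: complex multivector set) =
        cl_twisted_B (p+q) 0 r <#>\<^bsub>Cl (p+q) 0 r\<^esub>
          cl_invertible (p+q) 0 r (cl_twisted_Z (p+q) 0 r 2 \<inter> cl_twisted_Z (p+q) 0 r 3) \<and>
      (cl_B03 (p+q) 0 r :: complex multivector set) =
        cl_twisted_B (p+q) 0 r <#>\<^bsub>Cl (p+q) 0 r\<^esub> cl_invertible (p+q) 0 r (cl_Z (p+q) 0 r 3))"
  by (intro conjI cl_B_groups_factorization assms(3))

end
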